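(* Let $U \subset \mathbb{R}^n$ be a connected open subset, $n \geq 2$. For a function $f \colon U \to \mathbb{R}$, the following conditions are equivalent: (a) $f$ is regular; (b) for each $2$-dimensional affine plane $M \subset \mathbb{R}^n$ the restriction of $f$ is regular on each connected component of $U \cap M$.
   Context: For a subset $W\subset\mathbb{R}^n$, a function $g\colon W\to\mathbb{R}$ is regular if for every $x\in W$ there exist polynomials $p,q\in\mathbb{R}[x_1,\dots,x_n]$ with $q(x)\neq0$ and $g=p/q$ on $W\cap\{q\neq0\}$. *)

theory Defs
  imports "HOL-Analysis.Analysis"
begin

definition polynomial_fun :: "(real^'n \<Rightarrow> real) \<Rightarrow> bool" where
  "polynomial_fun p \<longleftrightarrow>
     (\<exists>A :: ('n \<Rightarrow> nat) set. \<exists>c :: ('n \<Rightarrow> nat) \<Rightarrow> real. finite A \<and>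
        (\<forall>x. p x = (\<Sum>\<alpha>\<in>A. c \<alpha> * (\<Prod>i\<in>UNIV. (x $ i) ^ (\<alpha> i)))))"

definition regular_on :: "(real^'n) set \<Rightarrow> (real^'n \<Rightarrow> real) \<Rightarrow> bool" where
  "regular_on W g \<longleftrightarrow>
     (\<forall>x\<in>W. \<exists>p q. polynomial_fun p \<and> polynomial_fun q \<and> q x \<noteq> 0 \<and>
        (\<forall>y\<in>W. q y \<noteq> 0 \<longrightarrow> g y = p y / q y))"

end

theory Submission
  imports Defs "HOL-Computational_Algebra.Polynomial_Factorial" "HOL-Computational_Algebra.Field_as_Ring"
begin

text \<open>
  Restricted to a segment in \<open>U\<close>, a function \<open>f\<close> that is regular on planes is a rational function of
  one variable. On a small box it is therefore separately rational, hence rational: adding one variable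
  at a time, linear dependence of the monomials and their products with \<open>f\<close> over infinitely many slices
  is lifted to dependence over rational functions of the new variable. By connectedness
  \<open>f Q = P\<close> on all of \<open>U\<close> for polynomials \<open>P\<close> and \<open>Q \<noteq> 0\<close>, which may be taken without common factor.

  It remains to see that \<open>Q\<close> has no zero \<open>a\<close> in \<open>U\<close>. Polynomial rings are factorial, so a Bezout relation
  \<open>A P + B Q = R\<close> holds with \<open>R \<noteq> 0\<close> independent of one chosen variable. On a plane through \<open>a\<close> in the direction of
  that variable, \<open>R\<close> becomes a one-variable polynomial, and comparing \<open>P / Q\<close> with a planar quotient
  \<open>p / q\<close> where \<open>q a \<noteq> 0\<close> shows that \<open>Q\<close> divides \<open>q\<close> locally at \<open>a\<close>.
\<close>

subsection \<open>Polynomial functions\<close>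

text \<open>Lines alone cannot settle regularity: x^3 / (x^2 + y^2), with value 0 at the origin, is
  regular on every line but not on the plane. So lines yield the quotient, and planes are needed
  again for its denominator. The obstacle there is that coprime P and Q may acquire a common factor
  on a plane, so coprimality cannot be used after restriction. What survives is the Bezout relation:
  if s is the plane coordinate transversal to the chosen variable, R becomes s^m r1(s) with r1(0)
  nonzero. The chosen variable runs along a line on which Q is not identically zero, so s does not
  divide the restricted Q and s^m cancels. What remains is that Q divides r1 q on the plane, which
  is impossible if Q vanishes at a while r1 and q do not. A second obstacle is that f is not assumed
  continuous; identities are therefore extended over exceptional sets along lines.\<close>

lemma polynomial_fun_indexed:
  fixes e :: "'j \<Rightarrow> 'n::finite \<Rightarrow> nat"
  assumes "finite J"
  shows "polynomial_fun (\<lambda>x::real^'n. \<Sum>j\<in>J. c j * (\<Prod>i\<in>UNIV. (x $ i) ^ (e j i)))"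
  unfolding polynomial_fun_def
proof (intro exI conjI allI)
  \<comment> \<open>Exponent vectors that occur several times are collected by adding their
    coefficients. Sums and products can then be indexed by disjoint unions and pairs.\<close>
  show "finite (e ` J)" using assms by simp
  fix x :: "real^'n"
  show "(\<Sum>j\<in>J. c j * (\<Prod>i\<in>UNIV. (x $ i) ^ (e j i))) =
    (\<Sum>\<alpha>\<in>e ` J. (\<lambda>\<alpha>. \<Sum>j\<in>{j\<in>J. e j = \<alpha>}. c j) \<alpha> * (\<Prod>i\<in>UNIV. (x $ i) ^ (\<alpha> i)))"
    by (subst sum.image_gen[OF assms, of _ e]) (auto simp: sum_distrib_right intro!: sum.cong)
qed

lemma polynomial_fun_const: "polynomial_fun (\<lambda>x::real^'n. c)"
  using polynomial_fun_indexed[of "{()}" "\<lambda>_. c" "\<lambda>_ _. 0"] by simp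

lemma polynomial_fun_coord: "polynomial_fun (\<lambda>x::real^'n. x $ k)"
proof -
  have "(\<Prod>i\<in>UNIV. (x $ i) ^ (if i = k then 1 else 0)) = x $ k" for x :: "real^'n"
  proof -
    have "(\<Prod>i\<in>UNIV. (x $ i) ^ (if i = k then 1 else 0)) = (\<Prod>i\<in>UNIV. if i = k then x $ i else 1)"
      by (intro prod.cong) auto
    then show ?thesis by simp
  qed
  then show ?thesis
    using polynomial_fun_indexed[of "{()}" "\<lambda>_. 1" "\<lambda>_ i. if i = k then 1 else 0"] by simp
qed

lemma polynomial_fun_add:
  fixes p q :: "real^'n \<Rightarrow> real"
  assumes "polynomial_fun p" "polynomial_fun q"
  shows "polynomial_fun (\<lambda>x. p x + q x)"
proof -
  obtain A c where A: "finite A" "\<And>x. p x = (\<Sum>\<alpha>\<in>A. c \<alpha> * (\<Prod>i\<in>UNIV. (x $ i) ^ (\<alpha> i)))"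
    using assms(1) unfolding polynomial_fun_def by blast
  obtain B d where B: "finite B" "\<And>x. q x = (\<Sum>\<alpha>\<in>B. d \<alpha> * (\<Prod>i\<in>UNIV. (x $ i) ^ (\<alpha> i)))"
    using assms(2) unfolding polynomial_fun_def by blast
  have "polynomial_fun (\<lambda>x::real^'n. \<Sum>j\<in>A <+> B. case_sum c d j * (\<Prod>i\<in>UNIV. (x $ i) ^ (case_sum id id j i)))"
    using A B by (intro polynomial_fun_indexed) auto
  then show ?thesis using A B by (simp add: sum.Plus)
qed

lemma polynomial_fun_mult:
  fixes p q :: "real^'n \<Rightarrow> real"
  assumes "polynomial_fun p" "polynomial_fun q"
  shows "polynomial_fun (\<lambda>x. p x * q x)"
proof -
  obtain A c where A: "finite A" "\<And>x. p x = (\<Sum>\<alpha>\<in>A. c \<alpha> * (\<Prod>i\<in>UNIV. (x $ i) ^ (\<alpha> i)))"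
    using assms(1) unfolding polynomial_fun_def by blast
  obtain B d where B: "finite B" "\<And>x. q x = (\<Sum>\<alpha>\<in>B. d \<alpha> * (\<Prod>i\<in>UNIV. (x $ i) ^ (\<alpha> i)))"
    using assms(2) unfolding polynomial_fun_def by blast
  have "polynomial_fun (\<lambda>x::real^'n. \<Sum>j\<in>A \<times> B. (c (fst j) * d (snd j)) * (\<Prod>i\<in>UNIV. (x $ i) ^ (fst j i + snd j i)))"
    using A B by (intro polynomial_fun_indexed) auto
  moreover have "p x * q x = (\<Sum>j\<in>A \<times> B. (c (fst j) * d (snd j)) * (\<Prod>i\<in>UNIV. (x $ i) ^ (fst j i + snd j i)))" for x
    unfolding A B sum_product sum.cartesian_product
    by (intro sum.cong) (auto simp: power_add prod.distrib)
  ultimately show ?thesis by presburger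
qed

lemma polynomial_fun_induct [consumes 1, case_names const coord add mult]:
  fixes p :: "real^'n \<Rightarrow> real"
  assumes "polynomial_fun p"
    and const: "\<And>c. \<Phi> (\<lambda>x. c)"
    and coord: "\<And>k. \<Phi> (\<lambda>x. x $ k)"
    and add: "\<And>p q. \<Phi> p \<Longrightarrow> \<Phi> q \<Longrightarrow> \<Phi> (\<lambda>x. p x + q x)"
    and mult: "\<And>p q. \<Phi> p \<Longrightarrow> \<Phi> q \<Longrightarrow> \<Phi> (\<lambda>x. p x * q x)"
  shows "\<Phi> p"
proof -
  obtain A c where A: "finite A" "\<And>x. p x = (\<Sum>\<alpha>\<in>A. c \<alpha> * (\<Prod>i\<in>UNIV. (x $ i) ^ (\<alpha> i)))"
    using assms(1) unfolding polynomial_fun_def by blast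
  have pow: "\<Phi> (\<lambda>x. (x $ k) ^ m)" for k m
    by (induction m) (auto intro: const coord mult)
  have pr: "\<Phi> (\<lambda>x. (\<Prod>i\<in>I. (x $ i) ^ (\<alpha> i)))" if "finite I" for I :: "'n set" and \<alpha>
    using that by (induction I) (auto intro: const pow mult)
  have "\<Phi> (\<lambda>x. (\<Sum>\<alpha>\<in>A. c \<alpha> * (\<Prod>i\<in>UNIV. (x $ i) ^ (\<alpha> i))))"
    using A(1)
  proof (induction A)
    case empty
    show ?case by (simp add: const)
  next
    case (insert \<alpha> F)
    have "\<Phi> (\<lambda>x. c \<alpha> * (\<Prod>i\<in>UNIV. (x $ i) ^ (\<alpha> i)))" by (rule mult[OF const pr]) simp
    from add[OF this insert.IH] show ?case using insert.hyps by simp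
  qed
  moreover have "p = (\<lambda>x. (\<Sum>\<alpha>\<in>A. c \<alpha> * (\<Prod>i\<in>UNIV. (x $ i) ^ (\<alpha> i))))"
    using A(2) by auto
  ultimately show ?thesis by simp
qed

text \<open>A real polynomial is determined by its values, so the functions themselves serve as the
  polynomial ring. As a type they support \<open>dvd\<close> and can be coefficients of
  \<open>poly\<close>.\<close>

typedef (overloaded) 'n polyfun = "{p :: real^'n::finite \<Rightarrow> real. polynomial_fun p}"
  morphisms ev Abs_polyfun
  using polynomial_fun_const by blast

setup_lifting type_definition_polyfun

lemma polyfun_eqI: "(\<And>x. ev p x = ev q x) \<Longrightarrow> p = q"
  by (metis ev_inject ext)

instantiation polyfun :: (finite) comm_ring_1
begin

lift_definition zero_polyfun :: "'a polyfun" is "\<lambda>_. 0"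
  by (rule polynomial_fun_const)
lift_definition one_polyfun :: "'a polyfun" is "\<lambda>_. 1"
  by (rule polynomial_fun_const)
lift_definition plus_polyfun :: "'a polyfun \<Rightarrow> 'a polyfun \<Rightarrow> 'a polyfun" is "\<lambda>p q x. p x + q x"
  by (rule polynomial_fun_add)
lift_definition times_polyfun :: "'a polyfun \<Rightarrow> 'a polyfun \<Rightarrow> 'a polyfun" is "\<lambda>p q x. p x * q x"
  by (rule polynomial_fun_mult)
lift_definition uminus_polyfun :: "'a polyfun \<Rightarrow> 'a polyfun" is "\<lambda>p x. - p x"
  using polynomial_fun_mult[OF polynomial_fun_const[of "-1"]] by fastforce
definition minus_polyfun :: "'a polyfun \<Rightarrow> 'a polyfun \<Rightarrow> 'a polyfun" where
  "minus_polyfun p q = p + (- q)"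

instance
proof
  show "a - b = a + - b" for a b :: "'a polyfun"
    by (rule minus_polyfun_def)
  show "0 \<noteq> (1 :: 'a polyfun)"
    by transfer (metis zero_neq_one)
qed (transfer, simp add: algebra_simps)+

end

lift_definition Const :: "real \<Rightarrow> 'n::finite polyfun" is "\<lambda>c _. c"
  by (rule polynomial_fun_const)
lift_definition Coord :: "'n::finite \<Rightarrow> 'n polyfun" is "\<lambda>k x. x $ k"
  by (rule polynomial_fun_coord)

lemma ev_0 [simp]: "ev 0 x = 0" and ev_1 [simp]: "ev 1 x = 1"
  and ev_add [simp]: "ev (p + q) x = ev p x + ev q x"
  and ev_mult [simp]: "ev (p * q) x = ev p x * ev q x"
  and ev_uminus [simp]: "ev (- p) x = - ev p x"
  and ev_Const [simp]: "ev (Const c) x = c"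
  and ev_Coord [simp]: "ev (Coord k) x = x $ k"
  by (transfer, simp)+

lemma ev_diff [simp]: "ev (p - q) x = ev p x - ev q x"
  by (metis minus_polyfun_def ev_add ev_uminus diff_conv_add_uminus)

lemma ev_sum [simp]: "ev (sum f I) x = (\<Sum>i\<in>I. ev (f i) x)"
  by (induction I rule: infinite_finite_induct) auto

lemma ev_power [simp]: "ev (p ^ m) x = ev p x ^ m"
  by (induction m) auto

lemma polynomial_fun_ev [simp]: "polynomial_fun (ev p)"
  using ev by auto

lemma polynomial_funE:
  assumes "polynomial_fun p" obtains P where "\<And>x. p x = ev P x"
  using assms Abs_polyfun_inverse by (metis mem_Collect_eq)

lemma polyfun_induct [case_names const coord add mult]:
  fixes P :: "'n::finite polyfun"
  assumes "\<And>c. \<Phi> (Const c)" "\<And>k. \<Phi> (Coord k)"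
    "\<And>P Q. \<Phi> P \<Longrightarrow> \<Phi> Q \<Longrightarrow> \<Phi> (P + Q)" "\<And>P Q. \<Phi> P \<Longrightarrow> \<Phi> Q \<Longrightarrow> \<Phi> (P * Q)"
  shows "\<Phi> P"
proof -
  define \<Psi> where "\<Psi> p \<longleftrightarrow> (\<exists>P. p = ev P \<and> \<Phi> P)" for p
  have "\<Psi> (ev P)"
  proof (rule polynomial_fun_induct[OF polynomial_fun_ev])
    show "\<Psi> (\<lambda>x. c)" for c unfolding \<Psi>_def using assms(1)[of c] by (intro exI[of _ "Const c"]) auto
    show "\<Psi> (\<lambda>x. x $ k)" for k unfolding \<Psi>_def using assms(2)[of k] by (intro exI[of _ "Coord k"]) auto
    show "\<Psi> (\<lambda>x. p x + q x)" if "\<Psi> p" "\<Psi> q" for p q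
    proof -
      from that obtain P Q where "p = ev P" "\<Phi> P" "q = ev Q" "\<Phi> Q" unfolding \<Psi>_def by blast
      then show ?thesis unfolding \<Psi>_def using assms(3) by (intro exI[of _ "P + Q"]) auto
    qed
    show "\<Psi> (\<lambda>x. p x * q x)" if "\<Psi> p" "\<Psi> q" for p q
    proof -
      from that obtain P Q where "p = ev P" "\<Phi> P" "q = ev Q" "\<Phi> Q" unfolding \<Psi>_def by blast
      then show ?thesis unfolding \<Psi>_def using assms(4) by (intro exI[of _ "P * Q"]) auto
    qed
  qed
  then show ?thesis unfolding \<Psi>_def by (auto simp: ev_inject)
qed


section \<open>Substitution and restriction to lines and planes\<close>

lemma polyfun_compose:
  fixes P :: "'n::finite polyfun" and g :: "real^'m::finite \<Rightarrow> real^'n"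
  assumes "\<And>i x. g x $ i = ev (G i) x"
  obtains P' where "\<And>x. ev P' x = ev P (g x)"
proof -
  have "\<exists>P'. \<forall>x. ev P' x = ev P (g x)"
  proof (induction P rule: polyfun_induct)
    case (const c) show ?case by (rule exI[of _ "Const c"]) auto
  next
    case (coord k) show ?case by (rule exI[of _ "G k"]) (auto simp: assms)
  next
    case (add P Q)
    then obtain P' Q' where "\<forall>x. ev P' x = ev P (g x)" "\<forall>x. ev Q' x = ev Q (g x)" by blast
    then show ?case by (intro exI[of _ "P' + Q'"]) simp
  next
    case (mult P Q)
    then obtain P' Q' where "\<forall>x. ev P' x = ev P (g x)" "\<forall>x. ev Q' x = ev Q (g x)" by blast
    then show ?case by (intro exI[of _ "P' * Q'"]) simp
  qed
  then show thesis using that by blast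
qed

lemma polyfun_on_line:
  fixes P :: "'n::finite polyfun"
  obtains r :: "real poly" where "\<And>t. ev P (a + t *\<^sub>R v) = poly r t"
proof -
  have "\<exists>r :: real poly. \<forall>t. ev P (a + t *\<^sub>R v) = poly r t"
  proof (induction P rule: polyfun_induct)
    case (const c) show ?case by (rule exI[of _ "[:c:]"]) auto
  next
    case (coord k) show ?case by (rule exI[of _ "[:a $ k, v $ k:]"]) auto
  next
    case (add P Q)
    then obtain F G where "\<forall>t. ev P (a + t *\<^sub>R v) = poly F t" "\<forall>t. ev Q (a + t *\<^sub>R v) = poly G t" by blast
    then show ?case by (intro exI[of _ "F + G"]) simp
  next
    case (mult P Q)
    then obtain F G where "\<forall>t. ev P (a + t *\<^sub>R v) = poly F t" "\<forall>t. ev Q (a + t *\<^sub>R v) = poly G t" by blast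
    then show ?case by (intro exI[of _ "F * G"]) simp
  qed
  then show thesis using that by blast
qed

text \<open>The outer variable of \<open>F\<close> is s and the inner one is t, so divisibility by
  \<open>[:0, 1:]\<close> means divisibility by s.\<close>

lemma polyfun_on_plane:
  fixes P :: "'n::finite polyfun"
  obtains F :: "real poly poly"
  where "\<And>s t. ev P (a + s *\<^sub>R u + t *\<^sub>R v) = poly (poly F [:s:]) t"
proof -
  have "\<exists>F :: real poly poly. \<forall>s t. ev P (a + s *\<^sub>R u + t *\<^sub>R v) = poly (poly F [:s:]) t"
  proof (induction P rule: polyfun_induct)
    case (const c) show ?case by (rule exI[of _ "[:[:c:]:]"]) auto
  next
    case (coord k)
    show ?case by (rule exI[of _ "[:[:a $ k, v $ k:], [:u $ k:]:]"]) simp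
  next
    case (add P Q)
    then obtain F G where "\<forall>s t. ev P (a + s *\<^sub>R u + t *\<^sub>R v) = poly (poly F [:s:]) t" "\<forall>s t. ev Q (a + s *\<^sub>R u + t *\<^sub>R v) = poly (poly G [:s:]) t" by blast
    then show ?case by (intro exI[of _ "F + G"]) simp
  next
    case (mult P Q)
    then obtain F G where "\<forall>s t. ev P (a + s *\<^sub>R u + t *\<^sub>R v) = poly (poly F [:s:]) t" "\<forall>s t. ev Q (a + s *\<^sub>R u + t *\<^sub>R v) = poly (poly G [:s:]) t" by blast
    then show ?case by (intro exI[of _ "F * G"]) simp
  qed
  then show thesis using that by blast
qed

lemma poly_eq_0_if_infinite_roots:
  fixes r :: "'a::idom poly"
  assumes "infinite T" "\<And>t. t \<in> T \<Longrightarrow> poly r t = 0"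
  shows "r = 0"
  using assms poly_roots_finite[of r] by (metis (mono_tags, lifting) finite_subset mem_Collect_eq subsetI)

text \<open>A line joining a point where P is nonzero to one where Q is nonzero reduces the claim to
  real polynomials in one variable.\<close>

instance polyfun :: (finite) idom
proof
  fix P Q :: "'a polyfun"
  assume "P \<noteq> 0" "Q \<noteq> 0"
  then obtain x y where x: "ev P x \<noteq> 0" and y: "ev Q y \<noteq> 0"
    by (metis ev_0 polyfun_eqI)
  obtain p where p: "\<And>t. ev P (x + t *\<^sub>R (y - x)) = poly p t"
    using polyfun_on_line[of P x "y - x"] by blast
  obtain q where q: "\<And>t. ev Q (x + t *\<^sub>R (y - x)) = poly q t"
    using polyfun_on_line[of Q x "y - x"] by blast
  have "poly p 0 \<noteq> 0" "poly q 1 \<noteq> 0"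
    using x y p[of 0] q[of 1] by auto
  then have "p * q \<noteq> 0" by auto
  then obtain t where "poly (p * q) t \<noteq> 0" by (metis poly_all_0_iff_0)
  then have "ev (P * Q) (x + t *\<^sub>R (y - x)) \<noteq> 0" by (simp add: p q)
  moreover have "ev 0 (x + t *\<^sub>R (y - x)) = 0" by simp
  ultimately show "P * Q \<noteq> 0" by metis
qed

lemma polyfun_nonzero: "P \<noteq> 0 \<Longrightarrow> \<exists>x. ev P x \<noteq> 0"
  by (metis ev_0 polyfun_eqI)

subsection \<open>Prime divisors in polynomial extensions\<close>

definition subring_set :: "'a::comm_ring_1 set \<Rightarrow> bool" where
  "subring_set A \<longleftrightarrow> 0 \<in> A \<and> 1 \<in> A \<and> (\<forall>a\<in>A. \<forall>b\<in>A. a + b \<in> A \<and> a - b \<in> A \<and> a * b \<in> A)"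

text \<open>Divisibility is taken in the ambient ring; for the subrings considered below it agrees with
  divisibility inside the subring, by the quotient assumptions of the locale.\<close>

definition prime_in :: "'a::comm_ring_1 set \<Rightarrow> 'a \<Rightarrow> bool" where
  "prime_in A \<pi> \<longleftrightarrow> \<pi> \<in> A \<and> \<pi> \<noteq> 0 \<and> \<not> \<pi> dvd 1 \<and> (\<forall>a\<in>A. \<forall>b\<in>A. \<pi> dvd a * b \<longrightarrow> \<pi> dvd a \<or> \<pi> dvd b)"

text \<open>The form in which factoriality is used: with an additive degree that drops whenever a
  prime is cancelled, elements can be stripped of their primes by induction.\<close>

definition has_prime_divisors :: "'a::comm_ring_1 set \<Rightarrow> bool" where
  "has_prime_divisors A \<longleftrightarrow> (\<forall>c\<in>A. c \<noteq> 0 \<longrightarrow> \<not> c dvd 1 \<longrightarrow> (\<exists>\<pi>. prime_in A \<pi> \<and> \<pi> dvd c))"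

text \<open>The model is B = A[Z] with \<open>\<delta>\<close> the total degree. The number of
  variables is fixed by the type, so induction on variables passes through subrings of a single
  ambient domain.\<close>

locale poly_extension =
  fixes A B :: "'a::idom set" and Z :: 'a and \<delta> :: "'a \<Rightarrow> nat"
  assumes subring_A: "subring_set A" and subring_B: "subring_set B"
    and quotient_A: "\<And>a h. a \<in> A \<Longrightarrow> a \<noteq> 0 \<Longrightarrow> a * h \<in> A \<Longrightarrow> h \<in> A"
    and quotient_B: "\<And>a h. a \<in> B \<Longrightarrow> a \<noteq> 0 \<Longrightarrow> a * h \<in> B \<Longrightarrow> h \<in> B"
    and A_subset_B: "A \<subseteq> B" and Z_in_B: "Z \<in> B"
    and rep: "\<And>b. b \<in> B \<Longrightarrow> \<exists>c. (\<forall>i. coeff c i \<in> A) \<and> b = poly c Z"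
    and rep_inj: "\<And>c. (\<forall>i. coeff c i \<in> A) \<Longrightarrow> poly c Z = 0 \<Longrightarrow> c = 0"
    and \<delta>_mult: "\<And>a b. a \<noteq> 0 \<Longrightarrow> b \<noteq> 0 \<Longrightarrow> \<delta> (a * b) = \<delta> a + \<delta> b"
    and \<delta>_unit: "\<And>a. a \<noteq> 0 \<Longrightarrow> \<delta> a = 0 \<Longrightarrow> a dvd 1"
begin

lemma A_closed: "0 \<in> A" "1 \<in> A" "a \<in> A \<Longrightarrow> b \<in> A \<Longrightarrow> a + b \<in> A"
  "a \<in> A \<Longrightarrow> b \<in> A \<Longrightarrow> a - b \<in> A" "a \<in> A \<Longrightarrow> b \<in> A \<Longrightarrow> a * b \<in> A"
  using subring_A unfolding subring_set_def by auto

lemma B_closed: "0 \<in> B" "1 \<in> B" "a \<in> B \<Longrightarrow> b \<in> B \<Longrightarrow> a + b \<in> B"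
  "a \<in> B \<Longrightarrow> b \<in> B \<Longrightarrow> a - b \<in> B" "a \<in> B \<Longrightarrow> b \<in> B \<Longrightarrow> a * b \<in> B"
  using subring_B unfolding subring_set_def by auto

lemma A_in_B: "a \<in> A \<Longrightarrow> a \<in> B" using A_subset_B by auto

lemma power_in_B: "b \<in> B \<Longrightarrow> b ^ m \<in> B"
  by (induction m) (auto intro: B_closed)

lemma \<delta>_nonunit: "a \<noteq> 0 \<Longrightarrow> \<not> a dvd 1 \<Longrightarrow> \<delta> a > 0"
  using \<delta>_unit by blast

text \<open>The quotient by \<pi> again lies in B and has an expansion in Z; uniqueness of
  coefficients compares the two expansions.\<close>

lemma dvd_coeff:
  assumes "\<pi> \<in> A" "\<pi> \<noteq> 0" "\<And>i. coeff c i \<in> A" "\<pi> dvd poly c Z" "poly c Z \<in> B"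
  shows "\<pi> dvd coeff c i"
proof -
  obtain h where h: "poly c Z = \<pi> * h" using assms(4) by (auto elim: dvdE)
  have "h \<in> B" using quotient_B[of \<pi> h] assms h A_in_B by auto
  then obtain d where d: "\<And>i. coeff d i \<in> A" "h = poly d Z" using rep by blast
  have "poly (c - smult \<pi> d) Z = 0" using h d by simp
  then have "c - smult \<pi> d = 0"
    using rep_inj[of "c - smult \<pi> d"] assms d A_closed by simp
  then have "c = smult \<pi> d" by simp
  then show ?thesis by simp
qed

lemma not_dvd_coeff:
  fixes \<pi> :: 'a
  assumes "\<not> \<pi> dvd poly c Z"
  shows "\<exists>i. \<not> \<pi> dvd coeff c i"
proof (rule ccontr)
  assume "\<not> ?thesis"
  then have "\<pi> dvd (\<Sum>i\<le>degree c. coeff c i * Z ^ i)"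
    by (intro dvd_sum dvd_mult2) auto
  with assms show False by (simp add: poly_altdef)
qed

text \<open>Gauss's lemma: if i and j are the least indices of coefficients of g and h not divisible
  by \<pi>, then all terms but one of the product's coefficient of index i + j are divisible by
  \<pi>.\<close>

lemma prime_in_extension:
  assumes "prime_in A \<pi>"
  shows "prime_in B \<pi>"
proof -
  have \<pi>: "\<pi> \<in> A" "\<pi> \<noteq> 0" "\<not> \<pi> dvd 1"
    and pr: "\<And>a b. a \<in> A \<Longrightarrow> b \<in> A \<Longrightarrow> \<pi> dvd a * b \<Longrightarrow> \<pi> dvd a \<or> \<pi> dvd b"
    using assms unfolding prime_in_def by auto
  have "\<pi> dvd g \<or> \<pi> dvd h" if gh: "g \<in> B" "h \<in> B" "\<pi> dvd g * h" for g h
  proof (rule ccontr)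
    assume neg: "\<not> (\<pi> dvd g \<or> \<pi> dvd h)"
    obtain c where c: "\<And>i. coeff c i \<in> A" "g = poly c Z" using rep gh by blast
    obtain d where d: "\<And>i. coeff d i \<in> A" "h = poly d Z" using rep gh by blast
    define i where "i = (LEAST i. \<not> \<pi> dvd coeff c i)"
    define j where "j = (LEAST j. \<not> \<pi> dvd coeff d j)"
    have i: "\<not> \<pi> dvd coeff c i" using not_dvd_coeff[of \<pi> c] neg c unfolding i_def
      by (metis (mono_tags, lifting) LeastI_ex)
    have j: "\<not> \<pi> dvd coeff d j" using not_dvd_coeff[of \<pi> d] neg d unfolding j_def
      by (metis (mono_tags, lifting) LeastI_ex)
    have less_i: "\<pi> dvd coeff c k" if "k < i" for k using that not_less_Least unfolding i_def by blast
    have less_j: "\<pi> dvd coeff d k" if "k < j" for k using that not_less_Least unfolding j_def by blast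
    have sum_in: "(\<Sum>k\<in>K. coeff c k * coeff d (m - k)) \<in> A" for K m
      by (induction K rule: infinite_finite_induct) (auto intro: A_closed c d)
    have "\<pi> dvd coeff (c * d) (i + j)"
      using gh c d B_closed \<pi> sum_in by (intro dvd_coeff) (auto simp: coeff_mult)
    moreover have eq: "coeff (c * d) (i + j) = coeff c i * coeff d j +
        (\<Sum>k\<in>{..i + j} - {i}. coeff c k * coeff d (i + j - k))"
      unfolding coeff_mult by (subst sum.remove[of _ i]) auto
    moreover have "\<pi> dvd (\<Sum>k\<in>{..i + j} - {i}. coeff c k * coeff d (i + j - k))"
    proof (rule dvd_sum)
      fix k assume "k \<in> {..i + j} - {i}"
      then have k: "k \<le> i + j" "k \<noteq> i" by auto
      show "\<pi> dvd coeff c k * coeff d (i + j - k)"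
      proof (cases "k < i")
        case True then show ?thesis by (simp add: less_i)
      next
        case False
        with k have "i + j - k < j" by linarith
        then show ?thesis by (simp add: less_j)
      qed
    qed
    ultimately have "\<pi> dvd coeff c i * coeff d j"
      by (simp only: eq dvd_add_left_iff)
    with pr[OF c(1) d(1)] i j show False by blast
  qed
  then show ?thesis using \<pi> A_in_B unfolding prime_in_def by auto
qed

lemma dvd_cancel_unit:
  assumes "c dvd 1" "D dvd c * X"
  shows "D dvd (X :: 'a)"
proof -
  obtain u where "1 = c * u" using assms(1) by (rule dvdE)
  then have "X = (c * X) * u" by (metis mult.assoc mult.commute mult_1)
  then show ?thesis using assms(2) by (metis dvd_mult2)
qed

text \<open>The content of D is split off prime by prime. A prime of c that divides D is moved into
  d. One that does not divide D is still prime in B, so it divides the cofactor in c X = D Y for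
  every X in F and can be cancelled from c.\<close>

lemma primitive_part_divides:
  assumes primes: "has_prime_divisors A"
    and "c \<in> A" "c \<noteq> 0" "D \<in> B" "D \<noteq> 0" "F \<subseteq> B" "\<And>X. X \<in> F \<Longrightarrow> D dvd c * X"
  shows "\<exists>d D1. d \<in> A \<and> D1 \<in> B \<and> D = d * D1 \<and> (\<forall>X\<in>F. D1 dvd X)"
  using assms(2-)
proof (induction "\<delta> c" arbitrary: c D rule: less_induct)
  case less
  show ?case
  proof (cases "c dvd 1")
    case True
    then have "D dvd X" if "X \<in> F" for X
      using less.prems(6)[OF that] dvd_cancel_unit by blast
    then show ?thesis using less.prems A_closed by (intro exI[of _ 1] exI[of _ D]) auto
  next
    case False
    then obtain \<pi> c' where \<pi>: "prime_in A \<pi>" and c': "c = \<pi> * c'"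
      using primes less.prems unfolding has_prime_divisors_def by (auto elim!: dvdE)
    have \<pi>A: "\<pi> \<in> A" "\<pi> \<noteq> 0" "\<not> \<pi> dvd 1" using \<pi> unfolding prime_in_def by auto
    have c'0: "c' \<noteq> 0" using c' less.prems(2) by auto
    have c'A: "c' \<in> A" using quotient_A[OF \<pi>A(1,2)] c' less.prems(1) by blast
    have lt: "\<delta> c' < \<delta> c"
      using \<delta>_mult[OF \<pi>A(2) c'0] \<delta>_nonunit[OF \<pi>A(2,3)] unfolding c' by linarith
    have \<pi>B: "\<And>a b. a \<in> B \<Longrightarrow> b \<in> B \<Longrightarrow> \<pi> dvd a * b \<Longrightarrow> \<pi> dvd a \<or> \<pi> dvd b"
      using prime_in_extension[OF \<pi>] unfolding prime_in_def by auto
    show ?thesis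
    proof (cases "\<pi> dvd D")
      case True
      then obtain D' where D': "D = \<pi> * D'" by (auto elim: dvdE)
      have D'B: "D' \<in> B" using quotient_B[of \<pi> D'] D' less.prems(3) \<pi>A A_in_B by blast
      have D'0: "D' \<noteq> 0" using D' less.prems(4) by auto
      have "D' dvd c' * X" if "X \<in> F" for X
        using less.prems(6)[OF that] \<pi>A unfolding D' c' by (simp add: mult.assoc)
      from less.hyps[OF lt c'A c'0 D'B D'0 less.prems(5) this]
      obtain d D1 where "d \<in> A" "D1 \<in> B" "D' = d * D1" "\<forall>X\<in>F. D1 dvd X" by blast
      then show ?thesis using \<pi>A A_closed D' by (intro exI[of _ "\<pi> * d"] exI[of _ D1]) auto
    next
      case False
      have "D dvd c' * X" if X: "X \<in> F" for X
      proof -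
        obtain Y where Y: "c * X = D * Y" using less.prems(6)[OF X] by (auto elim: dvdE)
        have "c * X \<in> B" using B_closed(5)[OF A_in_B[OF less.prems(1)]] X less.prems(5) by blast
        then have YB: "Y \<in> B" using quotient_B[of D Y] less.prems(3,4) Y by metis
        have "\<pi> dvd D * Y" using Y c' by (metis dvd_triv_left mult.assoc)
        then have "\<pi> dvd Y" using \<pi>B[OF less.prems(3) YB] False by blast
        then obtain Y' where "Y = \<pi> * Y'" by (auto elim: dvdE)
        then have "\<pi> * (c' * X) = \<pi> * (D * Y')" using Y c' by (simp add: algebra_simps)
        then show ?thesis using \<pi>A by simp
      qed
      from less.hyps[OF lt c'A c'0 less.prems(3,4,5) this] show ?thesis .
    qed
  qed
qed

text \<open>Euclid's algorithm over the fraction field of A with denominators cleared: a nonzero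
  element of the ideal (P, Q) of least degree in Z divides every element of the ideal up to a
  nonzero factor from A.\<close>

lemma minimal_combination:
  assumes PQ: "P \<in> B" "Q \<in> B" "P \<noteq> 0 \<or> Q \<noteq> 0"
  shows "\<exists>a b c. a \<in> B \<and> b \<in> B \<and> c \<in> A \<and> c \<noteq> 0 \<and> a * P + b * Q \<noteq> 0 \<and>
    (a * P + b * Q) dvd c * P \<and> (a * P + b * Q) dvd c * Q"
proof -
  \<comment> \<open>The ideal (P, Q), represented by coefficient polynomials over A so that the
    degree in Z is available.\<close>
  define J where "J = {g. (\<forall>i. coeff g i \<in> A) \<and> (\<exists>a\<in>B. \<exists>b\<in>B. poly g Z = a * P + b * Q)}"
  have JI: "g \<in> J" if "\<forall>i. coeff g i \<in> A" "a \<in> B" "b \<in> B" "poly g Z = a * P + b * Q" for g a b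
    using that unfolding J_def by blast
  have "\<exists>g\<in>J. g \<noteq> 0"
  proof -
    obtain p where p: "\<forall>i. coeff p i \<in> A" "P = poly p Z" using rep PQ by blast
    obtain q where q: "\<forall>i. coeff q i \<in> A" "Q = poly q Z" using rep PQ by blast
    have "p \<in> J" using JI[OF p(1) B_closed(2,1)] p(2) by simp
    moreover have "q \<in> J" using JI[OF q(1) B_closed(1,2)] q(2) by simp
    ultimately show ?thesis using PQ(3) p q by (metis poly_0)
  qed
  then obtain g0 where g0: "g0 \<in> J \<and> g0 \<noteq> 0" by blast
  define d where "d = arg_min degree (\<lambda>g. g \<in> J \<and> g \<noteq> 0)"
  have d: "d \<in> J" "d \<noteq> 0"
    using arg_min_natI[of "\<lambda>g. g \<in> J \<and> g \<noteq> 0", OF g0, of degree] unfolding d_def by auto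
  have d_min: "degree d \<le> degree g" if "g \<in> J" "g \<noteq> 0" for g
    unfolding d_def using that by (intro arg_min_nat_le) auto
  have J_red: "smult u g - monom v m * d \<in> J" if "g \<in> J" "u \<in> A" "v \<in> A" for g u v m
  proof -
    obtain a b where ab: "a \<in> B" "b \<in> B" "poly g Z = a * P + b * Q" using \<open>g \<in> J\<close> unfolding J_def by blast
    obtain a' b' where ab': "a' \<in> B" "b' \<in> B" "poly d Z = a' * P + b' * Q" using d unfolding J_def by blast
    have "poly (smult u g - monom v m * d) Z = (u * a - v * Z ^ m * a') * P + (u * b - v * Z ^ m * b') * Q"
      using ab ab' by (simp add: poly_monom algebra_simps)
    moreover have "u * a - v * Z ^ m * a' \<in> B" "u * b - v * Z ^ m * b' \<in> B"
      using ab ab' that A_in_B power_in_B[OF Z_in_B] by (auto intro!: B_closed)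
    moreover have "coeff (smult u g - monom v m * d) i \<in> A" for i
      using that d A_closed unfolding J_def by (auto simp: coeff_monom_mult)
    ultimately show ?thesis unfolding J_def by blast
  qed
  have lc: "lead_coeff d \<in> A" "lead_coeff d \<noteq> 0" using d unfolding J_def by auto
  have red: "\<exists>c\<in>A. c \<noteq> 0 \<and> d dvd smult c g" if "g \<in> J" for g
    using that
  proof (induction "degree g" arbitrary: g rule: less_induct)
    case less
    show ?case
    proof (cases "g = 0")
      case True then show ?thesis using A_closed by (intro bexI[of _ 1]) auto
    next
      case False
      have deg: "degree d \<le> degree g" using d_min less.prems False by blast
      \<comment> \<open>One step of pseudo-division: scaling by the leading coefficient of d keeps
        all coefficients in A.\<close>
      define r where "r = smult (lead_coeff d) g - monom (lead_coeff g) (degree g - degree d) * d"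
      have r: "r \<in> J" unfolding r_def
        using J_red less.prems lc unfolding J_def by blast
      \<comment> \<open>In degree 0 the degree cannot drop any further; there cancelling the leading
        term leaves 0.\<close>
      have "r = 0 \<or> degree r < degree g"
      proof (cases "degree g = 0")
        case True
        then have "degree d = 0" using deg by simp
        then obtain x y where "d = [:x:]" "g = [:y:]" using True degree_eq_zeroE by metis
        then show ?thesis unfolding r_def by (simp add: monom_0)
      next
        case g0: False
        have "degree r \<le> degree g" unfolding r_def using deg False
          by (intro degree_diff_le) (auto intro: order.trans[OF degree_mult_le] simp: degree_monom_eq)
        moreover have "coeff r (degree g) = 0"
          unfolding r_def using deg by (simp add: coeff_monom_mult)
        ultimately show ?thesis using g0
          by (metis leading_coeff_0_iff nless_le)
      qed
      then have "\<exists>c\<in>A. c \<noteq> 0 \<and> d dvd smult c r"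
        using less.hyps r A_closed by (metis dvd_0_right smult_0_right zero_neq_one)
      then obtain c where c: "c \<in> A" "c \<noteq> 0" "d dvd smult c r" by blast
      have "smult (c * lead_coeff d) g = smult c r + smult c (monom (lead_coeff g) (degree g - degree d)) * d"
        unfolding r_def by (simp add: smult_diff_right)
      then have "d dvd smult (c * lead_coeff d) g" using c(3) by (metis dvd_add dvd_triv_right)
      then show ?thesis using c lc A_closed by (intro bexI[of _ "c * lead_coeff d"]) auto
    qed
  qed
  obtain a b where ab: "a \<in> B" "b \<in> B" "poly d Z = a * P + b * Q" using d unfolding J_def by blast
  have dvd: "\<exists>c\<in>A. c \<noteq> 0 \<and> poly d Z dvd c * X" if X: "X \<in> {P, Q}" for X
  proof -
    obtain g where g: "\<forall>i. coeff g i \<in> A" "X = poly g Z" using rep X PQ by blast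
    have "g \<in> J"
      using X JI[OF g(1) B_closed(2,1)] JI[OF g(1) B_closed(1,2)] g(2) by auto
    then obtain c where "c \<in> A" "c \<noteq> 0" "d dvd smult c g" using red by blast
    then show ?thesis using g by (metis dvd_def poly_mult poly_smult)
  qed
  obtain c1 where c1: "c1 \<in> A" "c1 \<noteq> 0" "poly d Z dvd c1 * P" using dvd by blast
  obtain c2 where c2: "c2 \<in> A" "c2 \<noteq> 0" "poly d Z dvd c2 * Q" using dvd by blast
  have "poly d Z \<noteq> 0" using rep_inj d unfolding J_def by blast
  moreover have "poly d Z dvd (c1 * c2) * P" "poly d Z dvd (c1 * c2) * Q"
    using dvd_mult[OF c1(3), of c2] dvd_mult[OF c2(3), of c1] by (simp_all add: ac_simps)
  moreover have "c1 * c2 \<in> A" "c1 * c2 \<noteq> 0" using c1 c2 A_closed(5) by auto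
  ultimately show ?thesis using ab by metis
qed

text \<open>After removal of its content, the minimal combination divides P and Q, hence is a unit
  D1. Multiplying by the inverse of D1 leaves only the content, which lies in A.\<close>

lemma bezout_extension:
  assumes primes: "has_prime_divisors A" and PQ: "P \<in> B" "Q \<in> B" "P \<noteq> 0 \<or> Q \<noteq> 0"
    and coprime: "\<And>G. G \<in> B \<Longrightarrow> G dvd P \<Longrightarrow> G dvd Q \<Longrightarrow> G dvd 1"
  shows "\<exists>a b. a \<in> B \<and> b \<in> B \<and> a * P + b * Q \<in> A \<and> a * P + b * Q \<noteq> 0"
proof -
  obtain a b c where abc: "a \<in> B" "b \<in> B" "c \<in> A" "c \<noteq> 0" "a * P + b * Q \<noteq> 0"
    "(a * P + b * Q) dvd c * P" "(a * P + b * Q) dvd c * Q"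
    using minimal_combination[OF PQ] by blast
  have "a * P + b * Q \<in> B" using abc PQ by (intro B_closed(3) B_closed(5))
  then obtain d D1 where d: "d \<in> A" "D1 \<in> B" "a * P + b * Q = d * D1" "\<forall>X\<in>{P, Q}. D1 dvd X"
    using primitive_part_divides[OF primes abc(3,4) _ abc(5), of "{P, Q}"] abc(6,7) PQ(1,2) by auto
  then have "D1 dvd 1" using coprime by auto
  then obtain u where u: "1 = D1 * u" by (rule dvdE)
  have "D1 \<noteq> 0" using u by auto
  then have "u \<in> B" using quotient_B[OF d(2), of u] u B_closed(2) by metis
  have "d = d * (D1 * u)" using u by simp
  also have "\<dots> = (d * D1) * u" by (simp only: mult.assoc)
  also have "\<dots> = (u * a) * P + (u * b) * Q" unfolding d(3)[symmetric] by (simp add: algebra_simps)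
  finally have eq: "(u * a) * P + (u * b) * Q = d" by simp
  have "d \<noteq> 0" using d abc by auto
  moreover have "u * a \<in> B" "u * b \<in> B" using \<open>u \<in> B\<close> abc(1,2) by (auto intro: B_closed(5))
  ultimately show ?thesis using eq d(1)
    by (intro exI[of _ "u * a"] exI[of _ "u * b"]) simp
qed

text \<open>If a prime of A divides q, irreducibility makes the two associated and Gauss's lemma
  applies. Otherwise, when q does not divide g, Bezout gives a q + b g = R in A, so q divides R h;
  the primes of R can be cancelled one by one because none of them divides q.\<close>

lemma irreducible_prime_in_extension:
  assumes primes: "has_prime_divisors A" and q: "q \<in> B" "q \<noteq> 0" "\<not> q dvd 1"
    and irred: "\<And>x. x \<in> B \<Longrightarrow> x dvd q \<Longrightarrow> \<not> x dvd 1 \<Longrightarrow> q dvd x"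
  shows "prime_in B q"
proof -
  have "q dvd g \<or> q dvd h" if gh: "g \<in> B" "h \<in> B" "q dvd g * h" for g h
  proof (cases "\<exists>\<pi>. prime_in A \<pi> \<and> \<pi> dvd q")
    case True
    then obtain \<pi> where \<pi>: "prime_in A \<pi>" "\<pi> dvd q" by blast
    then have "prime_in B \<pi>" using prime_in_extension by blast
    moreover have "q dvd \<pi>" using irred[of \<pi>] \<pi> A_in_B unfolding prime_in_def by auto
    ultimately show ?thesis using gh \<pi>(2) unfolding prime_in_def by (meson dvd_trans)
  next
    case noprime: False
    have cancel: "q dvd h" if "R \<in> A" "R \<noteq> 0" "q dvd R * h" for R
      using that
    proof (induction "\<delta> R" arbitrary: R rule: less_induct)
      case less
      show ?case
      proof (cases "R dvd 1")
        case True
        then show ?thesis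
          using less.prems dvd_cancel_unit by blast
      next
        case False
        then obtain \<pi> R' where \<pi>: "prime_in A \<pi>" and R': "R = \<pi> * R'"
          using primes less.prems unfolding has_prime_divisors_def by (auto elim!: dvdE)
        have \<pi>A: "\<pi> \<in> A" "\<pi> \<noteq> 0" "\<not> \<pi> dvd 1" using \<pi> unfolding prime_in_def by auto
        have R'0: "R' \<noteq> 0" using R' less.prems(2) by auto
        have R'A: "R' \<in> A" using quotient_A[OF \<pi>A(1,2)] R' less.prems(1) by blast
        have lt: "\<delta> R' < \<delta> R"
          using \<delta>_mult[OF \<pi>A(2) R'0] \<delta>_nonunit[OF \<pi>A(2,3)] unfolding R' by linarith
        obtain m where m: "R * h = q * m" using less.prems by (auto elim: dvdE)
        have "R * h \<in> B" by (rule B_closed(5)[OF A_in_B[OF less.prems(1)] gh(2)])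
        then have "m \<in> B" using quotient_B[of q m] q(1,2) m by metis
        moreover have "\<pi> dvd q * m" using m R' by (metis dvd_triv_left mult.assoc)
        ultimately have "\<pi> dvd m"
          using prime_in_extension[OF \<pi>] noprime \<pi> q unfolding prime_in_def by blast
        then obtain m' where "m = \<pi> * m'" by (auto elim: dvdE)
        then have "\<pi> * (R' * h) = \<pi> * (q * m')" using m R' by (simp add: algebra_simps)
        then have "q dvd R' * h" using \<pi>A by simp
        then show ?thesis using less.hyps[OF lt R'A R'0] by blast
      qed
    qed
    show ?thesis
    proof (cases "q dvd g")
      case False
      have "\<exists>a b. a \<in> B \<and> b \<in> B \<and> a * q + b * g \<in> A \<and> a * q + b * g \<noteq> 0"
      proof (rule bezout_extension[OF primes q(1) gh(1)])
        show "G dvd 1" if "G \<in> B" "G dvd q" "G dvd g" for G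
          using irred[OF that(1,2)] that(3) False dvd_trans by blast
      qed (use q in auto)
      then obtain a b where ab: "a * q + b * g \<in> A" "a * q + b * g \<noteq> 0" by blast
      have "(a * q + b * g) * h = q * (a * h) + b * (g * h)" by (simp add: algebra_simps)
      then have "q dvd (a * q + b * g) * h" using gh(3) by simp
      then show ?thesis using cancel ab by blast
    qed auto
  qed
  then show ?thesis using q unfolding prime_in_def by auto
qed

text \<open>A nonunit divisor q of least degree is irreducible: if q = x y with x a nonunit, then x
  has at least the degree of q, so y has degree 0 and is a unit.\<close>

lemma has_prime_divisors_extension:
  assumes primes: "has_prime_divisors A"
  shows "has_prime_divisors B"
  unfolding has_prime_divisors_def
proof (intro ballI impI)
  fix c assume c: "c \<in> B" "c \<noteq> 0" "\<not> c dvd 1"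
  define N where "N = {q \<in> B. q dvd c \<and> \<not> q dvd 1}"
  define q where "q = arg_min \<delta> (\<lambda>q. q \<in> N)"
  have "c \<in> N" using c unfolding N_def by auto
  then have qN: "q \<in> N" unfolding q_def by (metis arg_min_natI)
  have q_min: "\<delta> q \<le> \<delta> x" if "x \<in> N" for x
    using that unfolding q_def by (rule arg_min_nat_le)
  have q: "q \<in> B" "q \<noteq> 0" "\<not> q dvd 1" "q dvd c" using qN c unfolding N_def by auto
  have "prime_in B q"
  proof (rule irreducible_prime_in_extension[OF primes q(1,2,3)])
    fix x assume x: "x \<in> B" "x dvd q" "\<not> x dvd 1"
    then have "x \<in> N" using q unfolding N_def by (auto intro: dvd_trans)
    then have le: "\<delta> q \<le> \<delta> x" by (rule q_min)
    obtain y where y: "q = x * y" using x by (auto elim: dvdE)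
    then have "x \<noteq> 0" "y \<noteq> 0" using q by auto
    then have "y dvd 1" using \<delta>_mult[of x y] le y \<delta>_unit[of y] by simp
    then show "q dvd x" using y by simp
  qed
  then show "\<exists>\<pi>. prime_in B \<pi> \<and> \<pi> dvd c" using q by blast
qed

end

subsection \<open>Total degree and dependence on variables\<close>

lemma inj_Const: "inj (Const :: real \<Rightarrow> 'n::finite polyfun)"
  by (metis ev_Const injI)

lemma infinite_range_Const: "infinite (range (Const :: real \<Rightarrow> 'n::finite polyfun))"
  using finite_imageD[OF _ inj_Const] infinite_UNIV_char_0[where 'a = real] by blast

lemma ev_poly: "ev (poly c Z) x = (\<Sum>i\<le>degree c. ev (coeff c i) x * ev Z x ^ i)"
  by (simp add: poly_altdef)

text \<open>The total degree of a polynomial function \<open>p\<close> is read off the expansion of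
  \<open>p (t v)\<close> in powers of the scalar \<open>t\<close>; this makes its additivity immediate.\<close>

definition dilation :: "'n::finite polyfun \<Rightarrow> 'n polyfun poly" where
  "dilation p = (SOME h. \<forall>t v. ev (poly h (Const t)) v = ev p (t *\<^sub>R v))"

definition tdegree :: "'n::finite polyfun \<Rightarrow> nat" where
  "tdegree p = degree (dilation p)"

text \<open>Makes the choice in \<open>dilation\<close> unique, whence its multiplicativity: over a
  domain a nonzero polynomial has finitely many roots, but there are infinitely many
  constants.\<close>

lemma dilation_unique_0:
  fixes h :: "'n::finite polyfun poly"
  assumes "\<And>t v. ev (poly h (Const t)) v = 0"
  shows "h = 0"
proof (rule poly_eq_0_if_infinite_roots[OF infinite_range_Const])
  fix T :: "'n polyfun" assume "T \<in> range Const"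
  then show "poly h T = 0" using assms by (auto intro: polyfun_eqI)
qed

lemma ev_dilation: "ev (poly (dilation p) (Const t)) v = ev p (t *\<^sub>R v)"
proof -
  have "\<exists>h. \<forall>t v. ev (poly h (Const t)) v = ev p (t *\<^sub>R v)"
  proof (induction p rule: polyfun_induct)
    case (const c)
    show ?case by (rule exI[of _ "[:Const c:]"]) simp
  next
    case (coord k)
    show ?case by (rule exI[of _ "[:0, Coord k:]"]) simp
  next
    case (add P Q)
    then obtain F G where "\<forall>t v. ev (poly F (Const t)) v = ev P (t *\<^sub>R v)"
      "\<forall>t v. ev (poly G (Const t)) v = ev Q (t *\<^sub>R v)" by blast
    then show ?case by (intro exI[of _ "F + G"]) simp
  next
    case (mult P Q)
    then obtain F G where "\<forall>t v. ev (poly F (Const t)) v = ev P (t *\<^sub>R v)"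
      "\<forall>t v. ev (poly G (Const t)) v = ev Q (t *\<^sub>R v)" by blast
    then show ?case by (intro exI[of _ "F * G"]) simp
  qed
  from someI_ex[OF this] show ?thesis unfolding dilation_def by blast
qed

lemma dilation_mult: "dilation (p * q) = dilation p * dilation q"
proof -
  have "dilation (p * q) - dilation p * dilation q = 0"
    by (rule dilation_unique_0) (simp add: ev_dilation)
  then show ?thesis by simp
qed

lemma dilation_nonzero: "p \<noteq> 0 \<Longrightarrow> dilation p \<noteq> 0"
proof
  assume "p \<noteq> 0" "dilation p = 0"
  have "ev p v = 0" for v
    using ev_dilation[of p 1 v] \<open>dilation p = 0\<close> by simp
  then have "p = 0" by (intro polyfun_eqI) simp
  with \<open>p \<noteq> 0\<close> show False by simp
qed

lemma tdegree_mult: "p \<noteq> 0 \<Longrightarrow> q \<noteq> 0 \<Longrightarrow> tdegree (p * q) = tdegree p + tdegree q"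
  unfolding tdegree_def dilation_mult by (rule degree_mult_eq) (auto dest: dilation_nonzero)

lemma constant_unit:
  assumes "p \<noteq> 0" "\<And>v. ev p v = ev p 0"
  shows "p dvd 1"
proof -
  have "ev p 0 \<noteq> 0" using assms by (metis polyfun_nonzero)
  have "1 = p * Const (1 / ev p 0)"
  proof (rule polyfun_eqI)
    fix x
    show "ev 1 x = ev (p * Const (1 / ev p 0)) x"
      using assms(2)[of x] \<open>ev p 0 \<noteq> 0\<close> by simp
  qed
  then show ?thesis by (rule dvdI)
qed

lemma tdegree_unit:
  assumes "p \<noteq> 0" "tdegree p = 0"
  shows "p dvd 1"
proof (rule constant_unit)
  obtain c where c: "dilation p = [:c:]" using assms degree_eq_zeroE unfolding tdegree_def by metis
  show "ev p v = ev p 0" for v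
    using ev_dilation[of p 1 v] ev_dilation[of p 0 v] c by simp
qed fact

text \<open>The polynomial subring in the variables S, encoded by values: ring closure is then
  immediate, and the expansion in powers of one variable is recovered in
  \<open>depends_on_insert\<close>.\<close>

definition depends_on :: "'n::finite set \<Rightarrow> 'n polyfun set" where
  "depends_on S = {p. \<forall>x y. (\<forall>i\<in>S. x $ i = y $ i) \<longrightarrow> ev p x = ev p y}"

lemma depends_onD: "p \<in> depends_on S \<Longrightarrow> (\<And>i. i \<in> S \<Longrightarrow> x $ i = y $ i) \<Longrightarrow> ev p x = ev p y"
  unfolding depends_on_def by blast

lemma subring_depends_on: "subring_set (depends_on S)"
  unfolding subring_set_def depends_on_def
proof (intro conjI ballI CollectI allI impI)
  fix a b :: "'a polyfun" and x y :: "real^'a"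
  assume "a \<in> {p. \<forall>x y. (\<forall>i\<in>S. x $ i = y $ i) \<longrightarrow> ev p x = ev p y}"
    and "b \<in> {p. \<forall>x y. (\<forall>i\<in>S. x $ i = y $ i) \<longrightarrow> ev p x = ev p y}"
    and "\<forall>i\<in>S. x $ i = y $ i"
  then have "ev a x = ev a y" "ev b x = ev b y" by blast+
  then show "ev (a + b) x = ev (a + b) y" "ev (a - b) x = ev (a - b) y" "ev (a * b) x = ev (a * b) y"
    by simp_all
qed simp_all

text \<open>At zeros of a the value of h cannot be found by division. Moving x and y by the same
  vector keeps them equal on S, and for a direction in which a is not identically zero the factor a
  cancels as a one-variable polynomial.\<close>

lemma depends_on_quotient:
  assumes a: "a \<in> depends_on S" "a \<noteq> 0" and ah: "a * h \<in> depends_on S"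
  shows "h \<in> depends_on S"
proof -
  have "ev h x = ev h y" if xy: "\<forall>i\<in>S. x $ i = y $ i" for x y
  proof -
    obtain u where u: "ev a u \<noteq> 0" using a polyfun_nonzero by blast
    define w where "w = u - x"
    obtain a1 where a1: "\<And>t. ev a (x + t *\<^sub>R w) = poly a1 t" using polyfun_on_line by blast
    obtain h1 where h1: "\<And>t. ev h (x + t *\<^sub>R w) = poly h1 t" using polyfun_on_line by blast
    obtain h2 where h2: "\<And>t. ev h (y + t *\<^sub>R w) = poly h2 t" using polyfun_on_line by blast
    have "poly (a1 * (h1 - h2)) t = 0" for t
    proof -
      have "ev a (x + t *\<^sub>R w) = ev a (y + t *\<^sub>R w)" by (rule depends_onD[OF a(1)]) (simp add: xy)
      moreover have "ev (a * h) (x + t *\<^sub>R w) = ev (a * h) (y + t *\<^sub>R w)"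
        by (rule depends_onD[OF ah]) (simp add: xy)
      ultimately show ?thesis by (simp add: algebra_simps flip: a1 h1 h2)
    qed
    then have "a1 * (h1 - h2) = 0" using poly_all_0_iff_0 by blast
    moreover have "poly a1 1 \<noteq> 0" using u a1[of 1] unfolding w_def by simp
    ultimately have "h1 = h2" by auto
    then show ?thesis using h1[of 0] h2[of 0] by simp
  qed
  then show ?thesis unfolding depends_on_def by blast
qed

lemma depends_on_coeff_mult:
  assumes "\<And>i. coeff c i \<in> depends_on S" "\<And>i. coeff d i \<in> depends_on S"
  shows "coeff (c * d) i \<in> depends_on S"
proof -
  have "(\<Sum>k\<in>K. coeff c k * coeff d (i - k)) \<in> depends_on S" for K
    using subring_depends_on[of S] assms unfolding subring_set_def
    by (induction K rule: infinite_finite_induct) auto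
  then show ?thesis by (simp add: coeff_mult)
qed

lemma depends_on_insert:
  fixes p :: "'n::finite polyfun"
  assumes "p \<in> depends_on (insert z S)"
  shows "\<exists>c. (\<forall>i. coeff c i \<in> depends_on S) \<and> p = poly c (Coord z)"
proof -
  \<comment> \<open>Induction over generators does not stay inside
    \<open>depends_on (insert z S)\<close>. Composing with the projection \<rho> gives a claim for
    every polynomial, and for the given p the projection changes nothing.\<close>
  define \<rho> :: "real^'n \<Rightarrow> real^'n" where "\<rho> x = (\<chi> i. if i \<in> insert z S then x $ i else 0)" for x
  have const_in: "Const r \<in> depends_on S" for r by (simp add: depends_on_def)
  have zero: "0 \<in> depends_on S" and one: "1 \<in> depends_on S" unfolding depends_on_def by simp_all
  have "\<exists>c. (\<forall>i. coeff c i \<in> depends_on S) \<and> (\<forall>x. ev (poly c (Coord z)) x = ev p (\<rho> x))"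
  proof (induction p rule: polyfun_induct)
    case (const r)
    show ?case
      by (rule exI[of _ "[:Const r:]"]) (auto simp: coeff_pCons zero const_in split: nat.splits)
  next
    case (coord k)
    have "Coord k \<in> depends_on S" if "k \<in> S" using that unfolding depends_on_def by simp
    then have "\<forall>i. coeff (if k = z then [:0, 1:] else if k \<in> S then [:Coord k:] else 0) i \<in> depends_on S"
      by (auto simp: coeff_pCons zero one split: nat.splits)
    then show ?case
      by (intro exI[of _ "if k = z then [:0, 1:] else if k \<in> S then [:Coord k:] else 0"])
        (auto simp: \<rho>_def)
  next
    case (add P Q)
    then obtain c d where cd: "\<forall>i. coeff c i \<in> depends_on S" "\<forall>x. ev (poly c (Coord z)) x = ev P (\<rho> x)"
      "\<forall>i. coeff d i \<in> depends_on S" "\<forall>x. ev (poly d (Coord z)) x = ev Q (\<rho> x)" by blast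
    then have "\<forall>i. coeff (c + d) i \<in> depends_on S"
      using subring_depends_on[of S] unfolding subring_set_def by simp
    then show ?case using cd by (intro exI[of _ "c + d"]) simp
  next
    case (mult P Q)
    then obtain c d where cd: "\<forall>i. coeff c i \<in> depends_on S" "\<forall>x. ev (poly c (Coord z)) x = ev P (\<rho> x)"
      "\<forall>i. coeff d i \<in> depends_on S" "\<forall>x. ev (poly d (Coord z)) x = ev Q (\<rho> x)" by blast
    then have "\<forall>i. coeff (c * d) i \<in> depends_on S"
      using depends_on_coeff_mult by blast
    then show ?case using cd by (intro exI[of _ "c * d"]) simp
  qed
  then obtain c where c: "\<forall>i. coeff c i \<in> depends_on S" "\<forall>x. ev (poly c (Coord z)) x = ev p (\<rho> x)"
    by blast
  have "ev p (\<rho> x) = ev p x" for x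
    by (rule depends_onD[OF assms]) (auto simp: \<rho>_def)
  then have "p = poly c (Coord z)" using c by (intro polyfun_eqI) simp
  then show ?thesis using c by blast
qed

lemma poly_Coord_eq_0:
  assumes "z \<notin> S" "\<forall>i. coeff c i \<in> depends_on S" "poly c (Coord z) = 0"
  shows "c = 0"
proof (rule poly_eqI)
  fix i
  have "ev (coeff c i) x = 0" for x
  proof -
    \<comment> \<open>Only coordinate z is varied, so the coefficients stay fixed and a real
      polynomial in t vanishes identically.\<close>
    define r where "r = map_poly (\<lambda>a. ev a x) c"
    have cr: "coeff r i = ev (coeff c i) x" for i unfolding r_def by (simp add: coeff_map_poly)
    have "poly r t = 0" for t
    proof -
      define y where "y = (\<chi> i. if i = z then t else x $ i)"
      have "ev (coeff c i) y = ev (coeff c i) x" for i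
        using assms(1,2) by (intro depends_onD[of "coeff c i" S]) (auto simp: y_def)
      moreover have "ev (Coord z) y = t" by (simp add: y_def)
      moreover have "ev (poly c (Coord z)) y = 0" using assms(3) by simp
      ultimately have "(\<Sum>i\<le>degree c. ev (coeff c i) x * t ^ i) = 0"
        unfolding ev_poly by simp
      moreover have "degree r \<le> degree c" unfolding r_def by (rule map_poly_degree_leq)
      then have "poly r t = (\<Sum>i\<le>degree c. coeff r i * t ^ i)"
        unfolding poly_altdef by (intro sum.mono_neutral_left) (auto simp: coeff_eq_0)
      ultimately show ?thesis by (simp add: cr)
    qed
    then have "r = 0" using poly_all_0_iff_0 by blast
    then show ?thesis using cr[of i] by simp
  qed
  then show "coeff c i = coeff 0 i" by (intro polyfun_eqI) simp
qed

lemma poly_extension_depends_on: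
  assumes "z \<notin> S"
  shows "poly_extension (depends_on S) (depends_on (insert z S)) (Coord z) tdegree"
proof (unfold_locales)
  show "depends_on S \<subseteq> depends_on (insert z S)" unfolding depends_on_def by auto
  show "Coord z \<in> depends_on (insert z S)" unfolding depends_on_def by simp
qed (use assms in \<open>auto intro: subring_depends_on depends_on_quotient depends_on_insert
    poly_Coord_eq_0 tdegree_mult tdegree_unit\<close>)

lemma has_prime_divisors_depends_on:
  "has_prime_divisors (depends_on (S :: 'n::finite set))"
  using finite[of S]
proof (induction S rule: finite_induct)
  case empty
  have "c dvd 1" if "c \<in> depends_on {}" "c \<noteq> 0" for c :: "'n polyfun"
    using that(2) depends_onD[OF that(1)] by (intro constant_unit) auto
  then show ?case unfolding has_prime_divisors_def by blast
next
  case (insert z S)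
  then show ?case
    using poly_extension.has_prime_divisors_extension[OF poly_extension_depends_on] by blast
qed

text \<open>The full ring is viewed as polynomials in the k-th variable over the ring in the
  remaining ones.\<close>

lemma polyfun_bezout:
  fixes P Q :: "'n::finite polyfun"
  assumes "P \<noteq> 0 \<or> Q \<noteq> 0" "\<And>G. G dvd P \<Longrightarrow> G dvd Q \<Longrightarrow> G dvd 1"
  obtains a b where "a * P + b * Q \<in> depends_on (UNIV - {k})" "a * P + b * Q \<noteq> 0"
proof -
  have ext: "poly_extension (depends_on (UNIV - {k})) (depends_on UNIV) (Coord k) tdegree"
    using poly_extension_depends_on[of k "UNIV - {k}"] by (simp add: insert_absorb)
  have all: "p \<in> depends_on UNIV" for p :: "'n polyfun"
    by (simp add: depends_on_def flip: vec_eq_iff)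
  have "\<exists>a b. a \<in> depends_on UNIV \<and> b \<in> depends_on UNIV \<and>
      a * P + b * Q \<in> depends_on (UNIV - {k}) \<and> a * P + b * Q \<noteq> 0"
    by (rule poly_extension.bezout_extension[OF ext has_prime_divisors_depends_on all all assms])
  then show thesis using that by blast
qed

subsection \<open>Rational functions of one real variable\<close>

text \<open>One pole-free quotient for all of J: infinitely many zeros in J then force the function
  to vanish on J, even across gaps of J.\<close>

definition rational_on :: "real set \<Rightarrow> (real \<Rightarrow> real) \<Rightarrow> bool" where
  "rational_on J g \<longleftrightarrow> (\<exists>p q. \<forall>t\<in>J. poly q t \<noteq> 0 \<and> g t = poly p t / poly q t)"

lemma rational_on_poly: "rational_on J (poly p)"
  unfolding rational_on_def by (intro exI[of _ p] exI[of _ 1]) simp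

lemma rational_on_const: "rational_on J (\<lambda>_. c)"
  unfolding rational_on_def by (intro exI[of _ "[:c:]"] exI[of _ 1]) simp

lemma rational_on_mult:
  assumes "rational_on J g" "rational_on J h"
  shows "rational_on J (\<lambda>t. g t * h t)"
proof -
  obtain p q where "\<forall>t\<in>J. poly q t \<noteq> 0 \<and> g t = poly p t / poly q t"
    using assms(1) unfolding rational_on_def by blast
  moreover obtain p' q' where "\<forall>t\<in>J. poly q' t \<noteq> 0 \<and> h t = poly p' t / poly q' t"
    using assms(2) unfolding rational_on_def by blast
  ultimately show ?thesis unfolding rational_on_def
    by (intro exI[of _ "p * p'"] exI[of _ "q * q'"]) simp
qed

lemma rational_on_add:
  assumes "rational_on J g" "rational_on J h"
  shows "rational_on J (\<lambda>t. g t + h t)"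
proof -
  obtain p q where "\<forall>t\<in>J. poly q t \<noteq> 0 \<and> g t = poly p t / poly q t"
    using assms(1) unfolding rational_on_def by blast
  moreover obtain p' q' where "\<forall>t\<in>J. poly q' t \<noteq> 0 \<and> h t = poly p' t / poly q' t"
    using assms(2) unfolding rational_on_def by blast
  ultimately show ?thesis unfolding rational_on_def
    by (intro exI[of _ "p * q' + p' * q"] exI[of _ "q * q'"]) (simp add: add_frac_eq)
qed

lemma rational_on_diff:
  assumes "rational_on J g" "rational_on J h"
  shows "rational_on J (\<lambda>t. g t - h t)"
  using rational_on_add[OF assms(1) rational_on_mult[OF rational_on_const[of J "-1"] assms(2)]] by simp

lemma rational_on_sum:
  assumes "\<And>i. i \<in> I \<Longrightarrow> rational_on J (g i)"
  shows "rational_on J (\<lambda>t. \<Sum>i\<in>I. g i t)"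
  using assms
  by (induction I rule: infinite_finite_induct) (auto intro: rational_on_const rational_on_add)

lemma rational_on_zero:
  assumes g: "rational_on J g" and Z: "Z \<subseteq> J" "infinite Z" "\<And>t. t \<in> Z \<Longrightarrow> g t = 0" and "t \<in> J"
  shows "g t = 0"
proof -
  obtain p q where pq: "\<And>t. t \<in> J \<Longrightarrow> poly q t \<noteq> 0 \<and> g t = poly p t / poly q t"
    using g unfolding rational_on_def by blast
  have "poly p s = 0" if "s \<in> Z" for s
    using pq[of s] Z that by auto
  then have "p = 0" using poly_eq_0_if_infinite_roots[OF Z(2)] by blast
  then show ?thesis using pq \<open>t \<in> J\<close> by simp
qed

lemma rational_on_finite_zeros:
  assumes "rational_on J g" "t \<in> J" "g t \<noteq> 0"
  shows "finite {s \<in> J. g s = 0}"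
proof (rule ccontr)
  assume "infinite {s \<in> J. g s = 0}"
  then have "g t = 0" by (rule rational_on_zero[OF assms(1) _ _ _ assms(2), rotated]) auto
  with assms(3) show False by contradiction
qed

lemma rational_on_common_denominator:
  assumes "finite I" "\<And>i. i \<in> I \<Longrightarrow> rational_on J (c i)"
  shows "\<exists>d p. (\<forall>t\<in>J. poly d t \<noteq> 0) \<and> (\<forall>i\<in>I. \<forall>t\<in>J. poly (p i) t = c i t * poly d t)"
  using assms
proof (induction I)
  case empty
  show ?case by (intro exI[of _ 1]) simp
next
  case (insert j I)
  then obtain d p where dp: "\<forall>t\<in>J. poly d t \<noteq> 0" "\<forall>i\<in>I. \<forall>t\<in>J. poly (p i) t = c i t * poly d t"
    by auto
  obtain u v where uv: "\<forall>t\<in>J. poly v t \<noteq> 0 \<and> c j t = poly u t / poly v t"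
    using insert.prems[of j] unfolding rational_on_def by blast
  define p' where "p' i = (if i = j then u * d else p i * v)" for i
  have "poly (p' i) t = c i t * poly (d * v) t" if "i \<in> insert j I" "t \<in> J" for i t
    using that uv dp unfolding p'_def by auto
  moreover have "\<forall>t\<in>J. poly (d * v) t \<noteq> 0" using uv dp by simp
  ultimately show ?case by (intro exI[of _ "d * v"] exI[of _ p']) blast
qed

text \<open>The one-variable model of the final argument. A local quotient in lowest terms p / q and
  any other local quotient p1 / q1 agree at infinitely many points, so p q1 = p1 q as polynomials.
  Hence q divides q1 and is nonzero wherever q1 is.\<close>

lemma rational_on_local:
  assumes "infinite J"
    and loc: "\<And>t0. t0 \<in> J \<Longrightarrow> \<exists>p q. poly q t0 \<noteq> 0 \<and> (\<forall>t\<in>J. poly q t \<noteq> 0 \<longrightarrow> g t = poly p t / poly q t)"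
  shows "rational_on J g"
proof -
  obtain t1 where "t1 \<in> J" using \<open>infinite J\<close> by (metis ex_in_conv finite.emptyI)
  then obtain p0 q0 where pq0: "poly q0 t1 \<noteq> 0" "\<forall>t\<in>J. poly q0 t \<noteq> 0 \<longrightarrow> g t = poly p0 t / poly q0 t"
    using loc by blast
  define p q where "p = p0 div gcd p0 q0" and "q = q0 div gcd p0 q0"
  have q0: "q0 \<noteq> 0" using pq0 by auto
  have p0q0: "p0 = p * gcd p0 q0" "q0 = q * gcd p0 q0" unfolding p_def q_def by simp_all
  have cop: "coprime q p" unfolding p_def q_def using q0 div_gcd_coprime[of q0 p0]
    by (simp add: gcd.commute)
  have "q \<noteq> 0" "gcd p0 q0 \<noteq> 0" using q0 p0q0(2) by auto
  have "poly q t0 \<noteq> 0 \<and> g t0 = poly p t0 / poly q t0" if t0: "t0 \<in> J" for t0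
  proof -
    obtain p1 q1 where pq1: "poly q1 t0 \<noteq> 0" "\<forall>t\<in>J. poly q1 t \<noteq> 0 \<longrightarrow> g t = poly p1 t / poly q1 t"
      using loc[OF t0] by blast
    have q1: "q1 \<noteq> 0" using pq1 by auto
    define R where "R = {t. poly (q0 * q1) t = 0}"
    have "finite R" unfolding R_def using q0 q1 by (intro poly_roots_finite) auto
    then have "infinite (J - R)" using \<open>infinite J\<close> by simp
    moreover have "poly (p0 * q1 - p1 * q0) t = 0" if "t \<in> J - R" for t
    proof -
      have nz: "poly q0 t \<noteq> 0" "poly q1 t \<noteq> 0" using that unfolding R_def by auto
      then have "poly p0 t / poly q0 t = poly p1 t / poly q1 t" using pq0 pq1 that by auto
      then show ?thesis using nz by (simp add: frac_eq_eq)
    qed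
    ultimately have "p0 * q1 - p1 * q0 = 0" by (rule poly_eq_0_if_infinite_roots)
    then have "gcd p0 q0 * (p * q1) = gcd p0 q0 * (p1 * q)"
      using p0q0 by (metis eq_iff_diff_eq_0 mult.assoc mult.commute)
    then have eq: "p * q1 = p1 * q"
      using \<open>gcd p0 q0 \<noteq> 0\<close> mult_left_cancel by blast
    then have "q dvd p * q1" by simp
    then have "q dvd q1" using cop by (simp add: coprime_dvd_mult_right_iff)
    then have nz: "poly q t0 \<noteq> 0" using pq1(1) by (auto elim!: dvdE)
    have "poly p t0 * poly q1 t0 = poly p1 t0 * poly q t0"
      using arg_cong[OF eq, of "\<lambda>r. poly r t0"] by simp
    then have "poly p1 t0 / poly q1 t0 = poly p t0 / poly q t0"
      using nz pq1(1) by (simp add: frac_eq_eq)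
    then show ?thesis using nz pq1 t0 by simp
  qed
  then show ?thesis unfolding rational_on_def by blast
qed

text \<open>Gaussian elimination over the ring of rational functions on \<open>J\<close>: dependence of the
  specializations at infinitely many parameters forces dependence over that ring.\<close>

lemma dependent_specializations:
  fixes h :: "'i \<Rightarrow> 'x \<Rightarrow> real \<Rightarrow> real"
  assumes "finite I" and "infinite T" "T \<subseteq> J"
    and "\<And>i x. i \<in> I \<Longrightarrow> x \<in> X \<Longrightarrow> rational_on J (h i x)"
    and "\<And>t. t \<in> T \<Longrightarrow> \<exists>a. (\<exists>i\<in>I. a i \<noteq> 0) \<and> (\<forall>x\<in>X. (\<Sum>i\<in>I. a i * h i x t) = 0)"
  shows "\<exists>c. (\<forall>i\<in>I. rational_on J (c i)) \<and> (\<exists>i\<in>I. \<exists>t\<in>J. c i t \<noteq> 0) \<and>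
    (\<forall>x\<in>X. \<forall>t\<in>J. (\<Sum>i\<in>I. c i t * h i x t) = 0)"
  using assms
proof (induction I arbitrary: h T)
  case empty
  then obtain t where "t \<in> T" by (metis ex_in_conv finite.emptyI)
  from empty.prems(4)[OF this] show ?case by simp
next
  case (insert j I)
  obtain t0 where t0: "t0 \<in> J" using insert.prems(1,2) by (metis ex_in_conv finite.emptyI subsetD)
  show ?case
  proof (cases "\<forall>x\<in>X. \<forall>t\<in>J. h j x t = 0")
    case True
    define c where "c i t = (if i = j then 1 else 0 :: real)" for i and t :: real
    have "rational_on J (c i)" for i unfolding c_def by (rule rational_on_const)
    moreover have "(\<Sum>i\<in>insert j I. c i t * h i x t) = 0" if "x \<in> X" "t \<in> J" for x t
      using insert.hyps True that unfolding c_def by (intro sum.neutral) auto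
    moreover have "c j t0 \<noteq> 0" unfolding c_def by simp
    ultimately show ?thesis using t0 by (intro exI[of _ c]) blast
  next
    case False
    then obtain x0 t1 where x0: "x0 \<in> X" "t1 \<in> J" "h j x0 t1 \<noteq> 0" by blast
    have fin: "finite {s \<in> J. h j x0 s = 0}"
      using x0 insert.prems(3)[of j x0] by (intro rational_on_finite_zeros) auto
    \<comment> \<open>The entry of column j at x0 is the pivot; it vanishes at only finitely many
      parameters, which are discarded. The functions \<open>h'\<close> are the remaining columns
      after elimination.\<close>
    define T' where "T' = T - {s \<in> J. h j x0 s = 0}"
    define h' where "h' i x t = h j x0 t * h i x t - h i x0 t * h j x t" for i x t
    have T': "infinite T'" "T' \<subseteq> J" using insert.prems(1,2) fin unfolding T'_def by auto
    have rat: "rational_on J (h' i x)" if "i \<in> I" "x \<in> X" for i x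
      unfolding h'_def using that x0 insert.prems(3)
      by (intro rational_on_diff rational_on_mult) auto
    have dep: "\<exists>a. (\<exists>i\<in>I. a i \<noteq> 0) \<and> (\<forall>x\<in>X. (\<Sum>i\<in>I. a i * h' i x t) = 0)" if "t \<in> T'" for t
    proof -
      have tT: "t \<in> T" and nz: "h j x0 t \<noteq> 0"
        using that insert.prems(2) unfolding T'_def by auto
      obtain a where a: "\<exists>i\<in>insert j I. a i \<noteq> 0" and a0: "\<forall>x\<in>X. (\<Sum>i\<in>insert j I. a i * h i x t) = 0"
        using insert.prems(4)[OF tT] by (elim exE conjE)
      have split: "a j * h j x t + (\<Sum>i\<in>I. a i * h i x t) = 0" if "x \<in> X" for x
        using bspec[OF a0 that] insert.hyps by simp
      have "(\<Sum>i\<in>I. a i * h' i x t) = 0" if "x \<in> X" for x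
      proof -
        have "(\<Sum>i\<in>I. a i * h' i x t) = h j x0 t * (\<Sum>i\<in>I. a i * h i x t) - h j x t * (\<Sum>i\<in>I. a i * h i x0 t)"
          unfolding h'_def by (simp add: sum_subtractf sum_distrib_left algebra_simps)
        also have "(\<Sum>i\<in>I. a i * h i x t) = - (a j * h j x t)"
          using split[OF that] by linarith
        also have "(\<Sum>i\<in>I. a i * h i x0 t) = - (a j * h j x0 t)"
          using split[OF x0(1)] by linarith
        finally show ?thesis by simp
      qed
      moreover have "\<exists>i\<in>I. a i \<noteq> 0"
      proof (rule ccontr)
        assume "\<not> ?thesis"
        then have "a j * h j x0 t = 0" using split[OF x0(1)] by simp
        then show False using nz a \<open>\<not> (\<exists>i\<in>I. a i \<noteq> 0)\<close> by auto
      qed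
      ultimately show ?thesis by blast
    qed
    from insert.IH[OF T' rat dep]
    obtain c i1 t2 where c: "\<forall>i\<in>I. rational_on J (c i)" "i1 \<in> I" "t2 \<in> J" "c i1 t2 \<noteq> 0"
      "\<forall>x\<in>X. \<forall>t\<in>J. (\<Sum>i\<in>I. c i t * h' i x t) = 0"
      by blast
    \<comment> \<open>Back substitution: the relation at x0 forces the coefficient of column j, and
      the others are scaled by the pivot instead of dividing by it.\<close>
    define c' where "c' i t = (if i = j then - (\<Sum>i\<in>I. c i t * h i x0 t) else c i t * h j x0 t)" for i t
    have c'j: "c' j = (\<lambda>t. 0 - (\<Sum>i\<in>I. c i t * h i x0 t))" unfolding c'_def by auto
    have c'I: "c' i = (\<lambda>t. c i t * h j x0 t)" if "i \<in> I" for i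
      using that insert.hyps unfolding c'_def by auto
    have rat': "rational_on J (c' i)" if "i \<in> insert j I" for i
    proof (cases "i = j")
      case True
      show ?thesis unfolding True c'j using c(1) x0(1) insert.prems(3)
        by (intro rational_on_diff rational_on_const rational_on_sum rational_on_mult) auto
    next
      case False
      then have "i \<in> I" using that by simp
      then show ?thesis using c'I c(1) x0(1) insert.prems(3) by (auto intro!: rational_on_mult)
    qed
    have "(\<Sum>i\<in>insert j I. c' i t * h i x t) = 0" if "x \<in> X" "t \<in> J" for x t
    proof -
      have "(\<Sum>i\<in>insert j I. c' i t * h i x t) = (\<Sum>i\<in>I. c i t * h' i x t)"
        using insert.hyps c'I unfolding h'_def
        by (simp add: c'j sum_subtractf sum_distrib_left sum_distrib_right algebra_simps)
      then show ?thesis using c(5) that by simp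
    qed
    moreover have "\<exists>t\<in>J. c' i1 t \<noteq> 0"
    proof -
      have "finite {s \<in> J. c i1 s = 0}" using c by (intro rational_on_finite_zeros) auto
      then have "infinite (T' - {s \<in> J. c i1 s = 0})" using T' by simp
      then obtain t where "t \<in> T' - {s \<in> J. c i1 s = 0}" by (metis ex_in_conv finite.emptyI)
      then have "t \<in> J" "c i1 t \<noteq> 0" "h j x0 t \<noteq> 0" using T'(2) unfolding T'_def by auto
      then show ?thesis using c'I[OF c(2)] by auto
    qed
    ultimately show ?thesis using rat' c(2) by (intro exI[of _ c']) blast
  qed
qed

section \<open>Monomials in a subset of the variables\<close>

lemma ev_poly_Const: "ev (poly (map_poly Const p) Z) x = poly p (ev Z x)"
proof (induction p)
  case 0
  then show ?case by simp
next
  case (pCons a p)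
  have "Const 0 = (0 :: 'a polyfun)" by (intro polyfun_eqI) simp
  then show ?case using pCons by (simp add: map_poly_pCons)
qed

text \<open>Variables outside S are set to 0. As \<open>0 ^ 0 = 1\<close>, monomials in S alone are
  unchanged and all others become 0, so the exponent vectors still range over all variables.\<close>

definition monomial_in :: "'n::finite set \<Rightarrow> ('n \<Rightarrow> nat) \<Rightarrow> 'n polyfun" where
  "monomial_in S \<alpha> = (\<Prod>i\<in>UNIV. (if i \<in> S then Coord i else 0) ^ \<alpha> i)"

lemma ev_prod: "ev (prod g I) x = (\<Prod>i\<in>I. ev (g i) x)"
  by (induction I rule: infinite_finite_induct) auto

lemma monomial_in_depends_on: "monomial_in S \<alpha> \<in> depends_on S"
  unfolding depends_on_def monomial_in_def by (auto simp: ev_prod intro!: prod.cong)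

lemma depends_on_monomials:
  fixes P :: "'n::finite polyfun"
  assumes "P \<in> depends_on S"
  obtains A c where "finite A" "\<And>x. ev P x = (\<Sum>\<alpha>\<in>A. c \<alpha> * ev (monomial_in S \<alpha>) x)"
proof -
  obtain A c where A: "finite A" "\<And>x. ev P x = (\<Sum>\<alpha>\<in>A. c \<alpha> * (\<Prod>i\<in>UNIV. (x $ i) ^ (\<alpha> i)))"
    using polynomial_fun_ev[of P] unfolding polynomial_fun_def by blast
  have "ev P x = (\<Sum>\<alpha>\<in>A. c \<alpha> * ev (monomial_in S \<alpha>) x)" for x
  proof -
    define y where "y = (\<chi> i. if i \<in> S then x $ i else 0)"
    have "ev P x = ev P y" by (rule depends_onD[OF assms]) (simp add: y_def)
    also have "\<dots> = (\<Sum>\<alpha>\<in>A. c \<alpha> * (\<Prod>i\<in>UNIV. (y $ i) ^ (\<alpha> i)))" by (rule A(2))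
    also have "\<dots> = (\<Sum>\<alpha>\<in>A. c \<alpha> * ev (monomial_in S \<alpha>) x)"
      unfolding monomial_in_def ev_prod by (intro sum.cong prod.cong arg_cong2[of _ _ _ _ "(*)"]) (auto simp: y_def)
    finally show ?thesis .
  qed
  with A(1) show thesis using that by blast
qed

subsection \<open>Separately rational functions\<close>

definition upd :: "real^'n \<Rightarrow> 'n \<Rightarrow> real \<Rightarrow> real^'n" where
  "upd x k t = (\<chi> i. if i = k then t else x $ i)"

lemma upd_nth [simp]: "upd x k t $ i = (if i = k then t else x $ i)"
  by (simp add: upd_def)

text \<open>The variables in S are free and the others are frozen at the values of b. The last
  clause excludes the trivial solution P = Q = 0 on the slice; securing it is what requires linearly
  independent monomials.\<close>

lemma separately_rational_imp_rational:
  fixes f :: "real^'n::finite \<Rightarrow> real" and c :: "real^'n" and r :: real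
  defines "K \<equiv> {x. \<forall>i. \<bar>x $ i - c $ i\<bar> < r}"
  assumes "r > 0"
    and rat: "\<And>x k. x \<in> K \<Longrightarrow> rational_on {t. \<bar>t - c $ k\<bar> < r} (\<lambda>t. f (upd x k t))"
    and "b \<in> K"
  shows "\<exists>P Q. P \<in> depends_on S \<and> Q \<in> depends_on S \<and>
    (\<forall>x\<in>K. (\<forall>i. i \<notin> S \<longrightarrow> x $ i = b $ i) \<longrightarrow> f x * ev Q x = ev P x) \<and>
    (\<exists>x\<in>K. (\<forall>i. i \<notin> S \<longrightarrow> x $ i = b $ i) \<and> ev Q x \<noteq> 0)"
  using finite[of S] \<open>b \<in> K\<close>
proof (induction S arbitrary: b rule: finite_induct)
  case (empty b)
  then show ?case
    by (intro exI[of _ "Const (f b)"] exI[of _ 1]) (auto simp: depends_on_def simp flip: vec_eq_iff)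
next
  case (insert z S b)
  define J where "J = {t. \<bar>t - c $ z\<bar> < r}"
  \<comment> \<open>The slice at height \<open>b $ z\<close>. Every other height t is reached by
    \<open>upd x z t\<close>, and monomials in S do not notice the change, so all heights share the
    parameter space X.\<close>
  define X where "X = {x\<in>K. \<forall>i. i \<notin> S \<longrightarrow> x $ i = b $ i}"
  define m where "m \<alpha> x = ev (monomial_in S \<alpha>) x" for \<alpha> x
  have J: "uncountable J"
  proof -
    have "J = {c $ z - r<..<c $ z + r}" unfolding J_def by auto
    then show ?thesis using \<open>r > 0\<close> by (simp add: uncountable_open_interval)
  qed
  have upd_K: "upd x z t \<in> K" if "x \<in> K" "t \<in> J" for x t
    using that unfolding K_def J_def by auto
  have m_upd: "m \<alpha> (upd x z t) = m \<alpha> x" for \<alpha> x t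
    unfolding m_def by (rule depends_onD[OF monomial_in_depends_on]) (use insert.hyps in auto)
  define good where "good A t \<longleftrightarrow> (\<exists>a a'. (\<forall>x\<in>X. f (upd x z t) * (\<Sum>\<alpha>\<in>A. a \<alpha> * m \<alpha> x) = (\<Sum>\<alpha>\<in>A. a' \<alpha> * m \<alpha> x)) \<and>
      (\<exists>x\<in>X. (\<Sum>\<alpha>\<in>A. a \<alpha> * m \<alpha> x) \<noteq> 0))" for A t
  have good_exists: "\<exists>A. finite A \<and> good A t" if t: "t \<in> J" for t
  proof -
    obtain P Q where PQ: "P \<in> depends_on S" "Q \<in> depends_on S"
      "\<forall>x\<in>K. (\<forall>i. i \<notin> S \<longrightarrow> x $ i = upd b z t $ i) \<longrightarrow> f x * ev Q x = ev P x"
      "\<exists>x\<in>K. (\<forall>i. i \<notin> S \<longrightarrow> x $ i = upd b z t $ i) \<and> ev Q x \<noteq> 0"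
      using insert.IH[OF upd_K[OF insert.prems t]] by blast
    have depPQ: "ev P (upd x z s) = ev P x" "ev Q (upd x z s) = ev Q x" for x s
      using insert.hyps by (auto intro!: depends_onD[OF PQ(1)] depends_onD[OF PQ(2)])
    have 1: "f (upd x z t) * ev Q x = ev P x" if "x \<in> X" for x
    proof -
      have "f (upd x z t) * ev Q (upd x z t) = ev P (upd x z t)"
        using PQ(3) upd_K[of x t] t that unfolding X_def by auto
      then show ?thesis by (simp add: depPQ)
    qed
    obtain y where y: "y \<in> K" "\<forall>i. i \<notin> S \<longrightarrow> y $ i = upd b z t $ i" "ev Q y \<noteq> 0" using PQ(4) by blast
    have "b $ z \<in> J" using insert.prems unfolding J_def K_def by auto
    then have "upd y z (b $ z) \<in> X" using y upd_K unfolding X_def by auto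
    then have 2: "\<exists>x\<in>X. ev Q x \<noteq> 0" using y(3) depPQ by metis
    obtain A p where A: "finite A" "\<And>x. ev P x = (\<Sum>\<alpha>\<in>A. p \<alpha> * m \<alpha> x)"
      using depends_on_monomials[OF PQ(1)] unfolding m_def by metis
    obtain B q where B: "finite B" "\<And>x. ev Q x = (\<Sum>\<alpha>\<in>B. q \<alpha> * m \<alpha> x)"
      using depends_on_monomials[OF PQ(2)] unfolding m_def by metis
    have P': "ev P x = (\<Sum>\<alpha>\<in>A \<union> B. (if \<alpha> \<in> A then p \<alpha> else 0) * m \<alpha> x)" for x
      unfolding A(2) using A(1) B(1) by (intro sum.mono_neutral_cong_left) auto
    have Q': "ev Q x = (\<Sum>\<alpha>\<in>A \<union> B. (if \<alpha> \<in> B then q \<alpha> else 0) * m \<alpha> x)" for x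
      unfolding B(2) using A(1) B(1) by (intro sum.mono_neutral_cong_left) auto
    have "good (A \<union> B) t" unfolding good_def
      by (rule exI[of _ "\<lambda>\<alpha>. if \<alpha> \<in> B then q \<alpha> else 0"], rule exI[of _ "\<lambda>\<alpha>. if \<alpha> \<in> A then p \<alpha> else 0"])
        (use 1[unfolded P' Q'] 2[unfolded Q'] in blast)
    then show ?thesis using A(1) B(1) by blast
  qed
  \<comment> \<open>There are only countably many finite sets of monomials, so one of them serves infinitely many
    slices. One of minimal cardinality is linearly independent on the slice.\<close>
  have "\<exists>A. finite A \<and> infinite {t\<in>J. good A t}"
  proof (rule ccontr)
    assume "\<not> ?thesis"
    then have fin: "countable {t\<in>J. good A t}" if "A \<in> Collect finite" for A
      using that by (auto intro: countable_finite)
    have "countable (Collect finite :: ('n \<Rightarrow> nat) set set)"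
      by (rule countable_Collect_finite)
    then have "countable (\<Union>A\<in>Collect finite. {t\<in>J. good A t})"
      using fin by (rule countable_UN)
    moreover have "J \<subseteq> (\<Union>A\<in>Collect finite. {t\<in>J. good A t})" using good_exists by blast
    ultimately show False using J countable_subset by blast
  qed
  then obtain A0 where A0: "finite A0 \<and> infinite {t\<in>J. good A0 t}" by blast
  define A where "A = arg_min card (\<lambda>A. finite A \<and> infinite {t\<in>J. good A t})"
  have A: "finite A" "infinite {t\<in>J. good A t}"
    using arg_min_natI[of "\<lambda>A. finite A \<and> infinite {t\<in>J. good A t}", OF A0, of card] unfolding A_def by auto
  have A_min: "card A \<le> card A'" if "finite A'" "infinite {t\<in>J. good A' t}" for A'
    unfolding A_def using that by (intro arg_min_nat_le) auto
  have indep: "d \<alpha>0 = 0" if d: "\<forall>x\<in>X. (\<Sum>\<alpha>\<in>A. d \<alpha> * m \<alpha> x) = 0" and \<alpha>0: "\<alpha>0 \<in> A" for d \<alpha>0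
  proof (rule ccontr)
    assume nz: "d \<alpha>0 \<noteq> 0"
    define A' where "A' = A - {\<alpha>0}"
    have red: "(\<Sum>\<alpha>\<in>A. a \<alpha> * m \<alpha> x) = (\<Sum>\<alpha>\<in>A'. (a \<alpha> - a \<alpha>0 / d \<alpha>0 * d \<alpha>) * m \<alpha> x)" if "x \<in> X" for a x
    proof -
      have s: "(\<Sum>\<alpha>\<in>A. g \<alpha>) = g \<alpha>0 + (\<Sum>\<alpha>\<in>A'. g \<alpha>)" for g :: "('n \<Rightarrow> nat) \<Rightarrow> real"
        unfolding A'_def using A(1) \<alpha>0 by (rule sum.remove)
      have "(\<Sum>\<alpha>\<in>A. (a \<alpha> - a \<alpha>0 / d \<alpha>0 * d \<alpha>) * m \<alpha> x) =
          (\<Sum>\<alpha>\<in>A. a \<alpha> * m \<alpha> x) - a \<alpha>0 / d \<alpha>0 * (\<Sum>\<alpha>\<in>A. d \<alpha> * m \<alpha> x)"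
        by (simp add: left_diff_distrib sum_subtractf sum_distrib_left mult.assoc)
      then show ?thesis using bspec[OF d that] nz
        unfolding s[of "\<lambda>\<alpha>. (a \<alpha> - a \<alpha>0 / d \<alpha>0 * d \<alpha>) * m \<alpha> x"] by simp
    qed
    have "good A' t" if gt: "good A t" for t
    proof -
      obtain a a' where aa: "\<forall>x\<in>X. f (upd x z t) * (\<Sum>\<alpha>\<in>A. a \<alpha> * m \<alpha> x) = (\<Sum>\<alpha>\<in>A. a' \<alpha> * m \<alpha> x)"
        "\<exists>x\<in>X. (\<Sum>\<alpha>\<in>A. a \<alpha> * m \<alpha> x) \<noteq> 0" using gt unfolding good_def by blast
      show ?thesis unfolding good_def
        by (rule exI[of _ "\<lambda>\<alpha>. a \<alpha> - a \<alpha>0 / d \<alpha>0 * d \<alpha>"], rule exI[of _ "\<lambda>\<alpha>. a' \<alpha> - a' \<alpha>0 / d \<alpha>0 * d \<alpha>"])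
          (use aa in \<open>simp add: red cong: bex_cong ball_cong\<close>)
    qed
    then have "infinite {t\<in>J. good A' t}"
      using A(2) finite_subset[of "{t\<in>J. good A t}" "{t\<in>J. good A' t}"] by blast
    moreover have "finite A'" "card A' < card A"
      unfolding A'_def using A(1) card_Diff1_less[OF A(1) \<alpha>0] by auto
    ultimately show False using A_min[of A'] by simp
  qed
  \<comment> \<open>A linear relation among these functions reads f times one combination plus
    another equals 0; hence the minus sign in the numerator P below.\<close>
  define h where "h i x t = (case i of Inl \<alpha> \<Rightarrow> f (upd x z t) * m \<alpha> x | Inr \<alpha> \<Rightarrow> m \<alpha> x)"
    for i :: "('n \<Rightarrow> nat) + ('n \<Rightarrow> nat)" and x and t :: real
  have h_rat: "rational_on J (h i x)" if "x \<in> X" for i x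
  proof (cases i)
    case (Inl \<alpha>)
    have "h i x = (\<lambda>t. f (upd x z t) * m \<alpha> x)" unfolding h_def Inl by simp
    moreover have "x \<in> K" using that unfolding X_def by simp
    ultimately show ?thesis
      using rational_on_mult[OF rat[of x z] rational_on_const] unfolding J_def by simp
  next
    case (Inr \<alpha>)
    have "h i x = (\<lambda>t. m \<alpha> x)" unfolding h_def Inr by simp
    then show ?thesis using rational_on_const by simp
  qed
  have split: "(\<Sum>i\<in>A <+> A. g i * h i x t) =
      f (upd x z t) * (\<Sum>\<alpha>\<in>A. g (Inl \<alpha>) * m \<alpha> x) + (\<Sum>\<alpha>\<in>A. g (Inr \<alpha>) * m \<alpha> x)" for g x t
    using A(1) by (simp add: sum.Plus h_def sum_distrib_left algebra_simps)
  have dep: "\<exists>a. (\<exists>i\<in>A <+> A. a i \<noteq> 0) \<and> (\<forall>x\<in>X. (\<Sum>i\<in>A <+> A. a i * h i x t) = 0)"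
    if tA: "t \<in> {t\<in>J. good A t}" for t
  proof -
    have "good A t" using tA by simp
    then obtain a a' x where aa: "\<forall>x\<in>X. f (upd x z t) * (\<Sum>\<alpha>\<in>A. a \<alpha> * m \<alpha> x) = (\<Sum>\<alpha>\<in>A. a' \<alpha> * m \<alpha> x)"
      "x \<in> X" "(\<Sum>\<alpha>\<in>A. a \<alpha> * m \<alpha> x) \<noteq> 0" unfolding good_def by blast
    obtain \<alpha> where "\<alpha> \<in> A" "a \<alpha> \<noteq> 0" using aa(3) by (metis (no_types, lifting) mult_zero_left sum.neutral)
    then have "\<exists>i\<in>A <+> A. case_sum a (\<lambda>\<alpha>. - a' \<alpha>) i \<noteq> 0" by (intro bexI[of _ "Inl \<alpha>"]) auto
    moreover have "\<forall>x\<in>X. (\<Sum>i\<in>A <+> A. case_sum a (\<lambda>\<alpha>. - a' \<alpha>) i * h i x t) = 0"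
      unfolding split using aa(1) by (simp add: sum_negf)
    ultimately show ?thesis by blast
  qed
  have "\<exists>c. (\<forall>i\<in>A <+> A. rational_on J (c i)) \<and> (\<exists>i\<in>A <+> A. \<exists>t\<in>J. c i t \<noteq> 0) \<and>
      (\<forall>x\<in>X. \<forall>t\<in>J. (\<Sum>i\<in>A <+> A. c i t * h i x t) = 0)"
    by (rule dependent_specializations[OF _ A(2) _ h_rat dep]) (use A(1) in auto)
  then obtain g i1 t1 where g: "\<forall>i\<in>A <+> A. rational_on J (g i)" "i1 \<in> A <+> A" "t1 \<in> J" "g i1 t1 \<noteq> 0"
    "\<forall>x\<in>X. \<forall>t\<in>J. (\<Sum>i\<in>A <+> A. g i t * h i x t) = 0"
    by blast
  obtain d p where dp: "\<forall>t\<in>J. poly d t \<noteq> 0" "\<forall>i\<in>A <+> A. \<forall>t\<in>J. poly (p i) t = g i t * poly d t"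
    using rational_on_common_denominator[of "A <+> A" J g] g(1) A(1) by auto
  have rel: "f (upd x z t) * (\<Sum>\<alpha>\<in>A. poly (p (Inl \<alpha>)) t * m \<alpha> x) = - (\<Sum>\<alpha>\<in>A. poly (p (Inr \<alpha>)) t * m \<alpha> x)"
    if "x \<in> X" "t \<in> J" for x t
  proof -
    have "(\<Sum>i\<in>A <+> A. poly (p i) t * h i x t) = (\<Sum>i\<in>A <+> A. g i t * h i x t) * poly d t"
      unfolding sum_distrib_right using dp(2) that(2) by (intro sum.cong) (auto simp: mult_ac)
    also have "\<dots> = 0" using g(5) that by simp
    finally show ?thesis unfolding split by linarith
  qed
  define Q where "Q = (\<Sum>\<alpha>\<in>A. poly (map_poly Const (p (Inl \<alpha>))) (Coord z) * monomial_in S \<alpha>)"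
  define P where "P = (\<Sum>\<alpha>\<in>A. poly (map_poly Const (- p (Inr \<alpha>))) (Coord z) * monomial_in S \<alpha>)"
  have evQ: "ev Q x = (\<Sum>\<alpha>\<in>A. poly (p (Inl \<alpha>)) (x $ z) * m \<alpha> x)" for x
    unfolding Q_def m_def by (simp add: ev_poly_Const)
  have evP: "ev P x = - (\<Sum>\<alpha>\<in>A. poly (p (Inr \<alpha>)) (x $ z) * m \<alpha> x)" for x
    unfolding P_def m_def by (simp add: ev_poly_Const sum_negf)
  have m_dep: "m \<alpha> x = m \<alpha> y" if "\<forall>i\<in>S. x $ i = y $ i" for \<alpha> x y
    unfolding m_def by (rule depends_onD[OF monomial_in_depends_on]) (use that in auto)
  have "P \<in> depends_on (insert z S)" "Q \<in> depends_on (insert z S)"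
    unfolding depends_on_def mem_Collect_eq evP evQ
    by (auto intro!: sum.cong arg_cong2[of _ _ _ _ "(*)"] m_dep)
  moreover have "f x * ev Q x = ev P x" if "x \<in> K" "\<forall>i. i \<notin> insert z S \<longrightarrow> x $ i = b $ i" for x
  proof -
    have "b $ z \<in> J" using insert.prems unfolding J_def K_def by auto
    then have "upd x z (b $ z) \<in> X" using that upd_K unfolding X_def by auto
    moreover have "x $ z \<in> J" using that unfolding J_def K_def by auto
    moreover have "upd (upd x z (b $ z)) z (x $ z) = x" by (simp add: vec_eq_iff)
    ultimately show ?thesis using rel[of "upd x z (b $ z)" "x $ z"] by (simp add: evP evQ m_upd)
  qed
  moreover have "\<exists>x\<in>K. (\<forall>i. i \<notin> insert z S \<longrightarrow> x $ i = b $ i) \<and> ev Q x \<noteq> 0"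
  proof (rule ccontr)
    \<comment> \<open>If Q vanished on the whole slice, then at height t1 both combinations would be
      0, and independence of the monomials would annihilate every coefficient there, including the
      nonzero one of index i1.\<close>
    assume neg: "\<not> ?thesis"
    have Q0: "(\<Sum>\<alpha>\<in>A. poly (p (Inl \<alpha>)) t1 * m \<alpha> x) = 0" if "x \<in> X" for x
    proof -
      have "upd x z t1 \<in> K" using that upd_K g(3) unfolding X_def by auto
      moreover have "\<forall>i. i \<notin> insert z S \<longrightarrow> upd x z t1 $ i = b $ i" using that unfolding X_def by auto
      ultimately have "ev Q (upd x z t1) = 0" using neg by blast
      then show ?thesis by (simp add: evQ m_upd)
    qed
    have P0: "(\<Sum>\<alpha>\<in>A. poly (p (Inr \<alpha>)) t1 * m \<alpha> x) = 0" if "x \<in> X" for x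
      using rel[OF that g(3)] Q0[OF that] by simp
    have "poly (p i1) t1 = 0"
      using g(2) indep[of "\<lambda>\<alpha>. poly (p (Inl \<alpha>)) t1"] indep[of "\<lambda>\<alpha>. poly (p (Inr \<alpha>)) t1"] Q0 P0 by auto
    then show False using dp g by auto
  qed
  ultimately show ?case by blast
qed

subsection \<open>Functions rational along lines\<close>

lemma regular_on_subset: "regular_on W f \<Longrightarrow> W' \<subseteq> W \<Longrightarrow> regular_on W' f"
  unfolding regular_on_def
proof (intro ballI)
  fix x
  assume reg: "\<forall>x\<in>W. \<exists>p q. polynomial_fun p \<and> polynomial_fun q \<and> q x \<noteq> 0 \<and> (\<forall>y\<in>W. q y \<noteq> 0 \<longrightarrow> f y = p y / q y)"
    and sub: "W' \<subseteq> W" and "x \<in> W'"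
  then have "x \<in> W" by blast
  with reg obtain p q where "polynomial_fun p \<and> polynomial_fun q \<and> q x \<noteq> 0 \<and> (\<forall>y\<in>W. q y \<noteq> 0 \<longrightarrow> f y = p y / q y)"
    by blast
  with sub show "\<exists>p q. polynomial_fun p \<and> polynomial_fun q \<and> q x \<noteq> 0 \<and> (\<forall>y\<in>W'. q y \<noteq> 0 \<longrightarrow> f y = p y / q y)"
    by blast
qed

lemma affine_plane:
  fixes a u v :: "'a::euclidean_space"
  assumes "v \<noteq> 0" "u \<notin> span {v}"
  shows "affine ((+) a ` span {u, v})" "aff_dim ((+) a ` span {u, v}) = 2"
proof -
  show "affine ((+) a ` span {u, v})"
    by (metis affine_translation subspace_imp_affine subspace_span)
  have "independent {u, v}" "u \<noteq> v"
    using assms span_base[of v "{v}"] by (auto simp: independent_insert)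
  then have "dim (span {u, v}) = 2"
    using dim_eq_card_independent[of "{u, v}"] by (simp add: dim_span)
  then show "aff_dim ((+) a ` span {u, v}) = 2"
    by (simp add: aff_dim_translation_eq aff_dim_subspace)
qed

lemma regular_on_planar_connected:
  assumes planes: "\<forall>M. affine M \<and> aff_dim M = 2 \<longrightarrow> (\<forall>C \<in> components (U \<inter> M). regular_on C f)"
    and "affine M" "aff_dim M = 2" "connected L" "L \<subseteq> U" "L \<subseteq> M"
  shows "regular_on L f"
proof (cases "L = {}")
  case True
  then show ?thesis unfolding regular_on_def by simp
next
  case False
  have "L \<subseteq> U \<inter> M" using assms by blast
  then obtain C where "C \<in> components (U \<inter> M)" "L \<subseteq> C"
    using exists_component_superset[of L "U \<inter> M"] assms(4) False by auto
  then show ?thesis using planes assms(2,3) regular_on_subset by blast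
qed

lemma exists_not_in_span:
  fixes v :: "real^'n"
  assumes "CARD('n) \<ge> 2"
  obtains u where "u \<notin> span {v}"
proof -
  have "dim (span {v}) \<le> 1" by (simp add: dim_span)
  then have "dim (span {v}) \<noteq> dim (UNIV :: (real^'n) set)" using assms by simp
  then have "span {v} \<noteq> UNIV" by metis
  then show thesis using that by blast
qed

text \<open>Any plane containing the line will do, and the dimension bound provides one.
  Connectedness of J keeps the segment inside a single component.\<close>

lemma rational_on_lines:
  fixes f :: "real^'n::finite \<Rightarrow> real"
  assumes planes: "\<forall>M. affine M \<and> aff_dim M = 2 \<longrightarrow> (\<forall>C \<in> components (U \<inter> M). regular_on C f)"
    and card: "CARD('n) \<ge> 2"
    and J: "connected J" "infinite J" and sub: "\<And>t. t \<in> J \<Longrightarrow> a + t *\<^sub>R v \<in> U"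
  shows "rational_on J (\<lambda>t. f (a + t *\<^sub>R v))"
proof (cases "v = 0")
  case True
  then show ?thesis by (simp add: rational_on_const)
next
  case False
  obtain u where u: "u \<notin> span {v}" using exists_not_in_span[OF card] by blast
  define L where "L = (\<lambda>t. a + t *\<^sub>R v) ` J"
  have "connected L" unfolding L_def
    by (intro connected_continuous_image continuous_intros J)
  moreover have "L \<subseteq> U" unfolding L_def using sub by auto
  moreover have "t *\<^sub>R v \<in> span {u, v}" for t
    by (intro span_scale span_base) simp
  then have "L \<subseteq> (+) a ` span {u, v}" unfolding L_def by blast
  ultimately have reg: "regular_on L f"
    using regular_on_planar_connected[OF planes affine_plane[OF False u]] by blast
  show ?thesis
  proof (rule rational_on_local[OF J(2)])
    fix t0 assume "t0 \<in> J"
    then have "a + t0 *\<^sub>R v \<in> L" unfolding L_def by blast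
    then obtain p q where pq: "polynomial_fun p" "polynomial_fun q" "q (a + t0 *\<^sub>R v) \<noteq> 0"
      "\<forall>y\<in>L. q y \<noteq> 0 \<longrightarrow> f y = p y / q y" using reg unfolding regular_on_def by blast
    obtain P where P: "\<And>x. p x = ev P x" using polynomial_funE[OF pq(1)] by blast
    obtain Q where Q: "\<And>x. q x = ev Q x" using polynomial_funE[OF pq(2)] by blast
    obtain p' where p': "\<And>t. ev P (a + t *\<^sub>R v) = poly p' t" using polyfun_on_line by blast
    obtain q' where q': "\<And>t. ev Q (a + t *\<^sub>R v) = poly q' t" using polyfun_on_line by blast
    have "poly q' t0 \<noteq> 0" using pq(3) Q q' by simp
    moreover have "\<forall>t\<in>J. poly q' t \<noteq> 0 \<longrightarrow> f (a + t *\<^sub>R v) = poly p' t / poly q' t"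
      using pq(4) P Q p' q' unfolding L_def by simp
    ultimately show "\<exists>p q. poly q t0 \<noteq> 0 \<and> (\<forall>t\<in>J. poly q t \<noteq> 0 \<longrightarrow> f (a + t *\<^sub>R v) = poly p t / poly q t)"
      by blast
  qed
qed

text \<open>All that is used of the planar hypothesis up to the reduced quotient.\<close>

definition rational_along_lines :: "(real^'n) set \<Rightarrow> (real^'n \<Rightarrow> real) \<Rightarrow> bool" where
  "rational_along_lines U f \<longleftrightarrow> (\<forall>a v J. connected J \<longrightarrow> infinite J \<longrightarrow>
     (\<forall>t\<in>J. a + t *\<^sub>R v \<in> U) \<longrightarrow> rational_on J (\<lambda>t. f (a + t *\<^sub>R v)))"

lemma rational_along_linesD:
  "rational_along_lines U f \<Longrightarrow> connected J \<Longrightarrow> infinite J \<Longrightarrow> (\<And>t. t \<in> J \<Longrightarrow> a + t *\<^sub>R v \<in> U) \<Longrightarrow>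
   rational_on J (\<lambda>t. f (a + t *\<^sub>R v))"
  unfolding rational_along_lines_def by blast

lemma rational_along_lines_subset:
  "rational_along_lines U f \<Longrightarrow> V \<subseteq> U \<Longrightarrow> rational_along_lines V f"
  unfolding rational_along_lines_def by blast

lemma infinite_symmetric_interval: "\<delta> > 0 \<Longrightarrow> infinite {- \<delta><..<\<delta> :: real}"
  by simp

lemma small_segment:
  fixes y v :: "'a::real_normed_vector"
  assumes "open U" "y \<in> U"
  obtains \<delta> :: real where "\<delta> > 0" "\<And>t. t \<in> {- \<delta><..<\<delta>} \<Longrightarrow> y + t *\<^sub>R v \<in> U"
proof -
  obtain e where e: "e > 0" "ball y e \<subseteq> U" using assms open_contains_ball by blast
  \<comment> \<open>The summand 1 keeps the denominator positive when v = 0.\<close>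
  define \<delta> where "\<delta> = e / (norm v + 1)"
  have "\<delta> > 0" unfolding \<delta>_def using e by (simp add: add_nonneg_pos)
  moreover have "y + t *\<^sub>R v \<in> U" if "t \<in> {- \<delta><..<\<delta>}" for t
  proof -
    have "\<bar>t\<bar> * norm v \<le> \<bar>t\<bar> * (norm v + 1)" by (simp add: mult_left_mono)
    also have "\<dots> < \<delta> * (norm v + 1)"
      using that by (intro mult_strict_right_mono) (auto simp: add_nonneg_pos)
    also have "\<dots> = e" unfolding \<delta>_def by (simp add: add_nonneg_eq_0_iff)
    finally have "y + t *\<^sub>R v \<in> ball y e" by (simp add: dist_norm)
    then show ?thesis using e by blast
  qed
  ultimately show thesis using that by blast
qed

text \<open>No continuity of f is at hand, so zeros of G are crossed on a line from y towards a
  point where G is nonzero: near y only finitely many points of that line are exceptional, and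
  rationality along it fills them in.\<close>

lemma rational_identity_extends:
  assumes rat: "rational_along_lines U f" and "open U" "y \<in> U" and "G \<noteq> 0"
    and eq: "\<And>x. x \<in> U \<Longrightarrow> ev G x \<noteq> 0 \<Longrightarrow> f x * ev Q x = ev P x"
  shows "f y * ev Q y = ev P y"
proof -
  obtain w where w: "ev G w \<noteq> 0" using polyfun_nonzero[OF \<open>G \<noteq> 0\<close>] by blast
  define v where "v = w - y"
  obtain \<delta> :: real where \<delta>: "\<delta> > 0" "\<And>t. t \<in> {- \<delta><..<\<delta>} \<Longrightarrow> y + t *\<^sub>R v \<in> U"
    using small_segment[OF assms(2,3), of v] by blast
  define J where "J = {- \<delta><..<\<delta>}"
  have J: "connected J" "infinite J" "0 \<in> J" unfolding J_def using \<delta>(1) by auto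
  obtain p where p: "\<And>t. ev P (y + t *\<^sub>R v) = poly p t" using polyfun_on_line by blast
  obtain q where q: "\<And>t. ev Q (y + t *\<^sub>R v) = poly q t" using polyfun_on_line by blast
  obtain g where g: "\<And>t. ev G (y + t *\<^sub>R v) = poly g t" using polyfun_on_line by blast
  have "poly g 1 \<noteq> 0" using w unfolding g[symmetric] v_def by simp
  then have "g \<noteq> 0" by auto
  then have inf: "infinite (J - {t. poly g t = 0})" using J(2) poly_roots_finite[of g] by simp
  define h where "h t = f (y + t *\<^sub>R v) * poly q t - poly p t" for t
  have "rational_on J (\<lambda>t. f (y + t *\<^sub>R v))"
    using rational_along_linesD[OF rat J(1,2)] \<delta>(2) unfolding J_def by blast
  then have rat_h: "rational_on J h"
    unfolding h_def by (intro rational_on_diff rational_on_mult rational_on_poly)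
  have "h t = 0" if "t \<in> J - {t. poly g t = 0}" for t
    unfolding h_def using that eq[of "y + t *\<^sub>R v"] \<delta>(2)[of t] g p q unfolding J_def by auto
  from rational_on_zero[OF rat_h _ inf this J(3)] have "h 0 = 0" by blast
  then have "f (y + 0 *\<^sub>R v) * poly q 0 - poly p 0 = 0" unfolding h_def .
  then show ?thesis using p[of 0] q[of 0] by simp
qed

lemma polyfun_eq_0_open:
  assumes "open V" "y \<in> V" "\<And>x. x \<in> V \<Longrightarrow> ev P x = 0"
  shows "P = 0"
proof (rule polyfun_eqI)
  fix w
  define v where "v = w - y"
  obtain \<delta> :: real where \<delta>: "\<delta> > 0" "\<And>t. t \<in> {- \<delta><..<\<delta>} \<Longrightarrow> y + t *\<^sub>R v \<in> V"
    using small_segment[OF assms(1,2), of v] by blast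
  obtain p where p: "\<And>t. ev P (y + t *\<^sub>R v) = poly p t" using polyfun_on_line by blast
  have "p = 0"
  proof (rule poly_eq_0_if_infinite_roots[OF infinite_symmetric_interval[OF \<delta>(1)]])
    show "poly p t = 0" if "t \<in> {- \<delta><..<\<delta>}" for t
      using assms(3) \<delta>(2)[OF that] p by metis
  qed
  then show "ev P w = ev 0 w" using p[of 1] unfolding v_def by simp
qed

lemma local_quotient:
  fixes f :: "real^'n::finite \<Rightarrow> real"
  assumes rat: "rational_along_lines U f" and "open U" "a \<in> U"
  shows "\<exists>V P Q. open V \<and> a \<in> V \<and> V \<subseteq> U \<and> Q \<noteq> 0 \<and> (\<forall>x\<in>V. f x * ev Q x = ev P x)"
proof -
  obtain e where e: "e > 0" "ball a e \<subseteq> U" using assms open_contains_ball by blast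
  \<comment> \<open>With this side length the l1 norm bounds the distance to a by e, so the box lies
    in the ball.\<close>
  define r where "r = e / CARD('n)"
  define V where "V = {x. \<forall>i. \<bar>x $ i - a $ i\<bar> < r}"
  have r: "r > 0" unfolding r_def using e by simp
  have "x \<in> ball a e" if "x \<in> V" for x
  proof -
    have "norm (x - a) \<le> (\<Sum>i\<in>UNIV. \<bar>(x - a) $ i\<bar>)" by (rule norm_le_l1_cart)
    also have "\<dots> < (\<Sum>i\<in>(UNIV :: 'n set). r)"
      using that unfolding V_def by (intro sum_strict_mono) auto
    also have "\<dots> = e" unfolding r_def by simp
    finally show ?thesis by (simp add: dist_norm norm_minus_commute)
  qed
  then have VU: "V \<subseteq> U" using e by blast
  have "V = (\<Inter>i\<in>UNIV. {x. \<bar>x $ i - a $ i\<bar> < r})" unfolding V_def by auto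
  moreover have "open {x :: real^'n. \<bar>x $ i - a $ i\<bar> < r}" for i
    by (intro open_Collect_less continuous_intros)
  ultimately have "open V" by (simp add: open_INT)
  have aV: "a \<in> V" unfolding V_def using r by simp
  have lines: "rational_on {t. \<bar>t - a $ k\<bar> < r} (\<lambda>t. f (upd x k t))" if x: "x \<in> V" for x k
  proof -
    have upd: "upd x k t = upd x k 0 + t *\<^sub>R axis k 1" for t
      by (simp add: vec_eq_iff axis_def)
    have J: "{t. \<bar>t - a $ k\<bar> < r} = {a $ k - r<..<a $ k + r}" by auto
    have "rational_on {a $ k - r<..<a $ k + r} (\<lambda>t. f (upd x k 0 + t *\<^sub>R axis k 1))"
    proof (rule rational_along_linesD[OF rat])
      fix t assume "t \<in> {a $ k - r<..<a $ k + r}"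
      then have "upd x k t \<in> V" using x unfolding V_def by auto
      then show "upd x k 0 + t *\<^sub>R axis k 1 \<in> U" using VU upd[of t] by (simp add: subset_iff)
    qed (use r in auto)
    then show ?thesis unfolding J upd[symmetric] .
  qed
  have "\<exists>P Q. P \<in> depends_on UNIV \<and> Q \<in> depends_on UNIV \<and>
    (\<forall>x\<in>V. (\<forall>i. i \<notin> (UNIV :: 'n set) \<longrightarrow> x $ i = a $ i) \<longrightarrow> f x * ev Q x = ev P x) \<and>
    (\<exists>x\<in>V. (\<forall>i. i \<notin> (UNIV :: 'n set) \<longrightarrow> x $ i = a $ i) \<and> ev Q x \<noteq> 0)"
    unfolding V_def
    by (rule separately_rational_imp_rational[OF r]) (use lines aV in \<open>auto simp: V_def\<close>)
  then obtain P Q where "\<forall>x\<in>V. f x * ev Q x = ev P x" "\<exists>x\<in>V. ev Q x \<noteq> 0" by auto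
  then show ?thesis using \<open>open V\<close> aV VU by (metis ev_0)
qed

text \<open>Fix one local quotient and let E be the largest open set on which it represents f. A
  local quotient elsewhere whose domain meets E agrees with the fixed one as a fraction, since their
  domains overlap in an open set; so its whole domain lies in E, and the complement of E in U is
  open.\<close>

lemma global_quotient:
  fixes f :: "real^'n::finite \<Rightarrow> real"
  assumes rat: "rational_along_lines U f" and U: "open U" "connected U" "U \<noteq> {}"
  shows "\<exists>P Q. Q \<noteq> 0 \<and> (\<forall>x\<in>U. f x * ev Q x = ev P x)"
proof -
  obtain a where "a \<in> U" using U by blast
  then obtain V0 P Q where V0: "open V0" "a \<in> V0" "V0 \<subseteq> U" "Q \<noteq> 0" "\<forall>x\<in>V0. f x * ev Q x = ev P x"
    using local_quotient[OF rat U(1) \<open>a \<in> U\<close>] by (elim exE conjE) (rule that)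
  define E where "E = \<Union>{V. open V \<and> V \<subseteq> U \<and> (\<forall>x\<in>V. f x * ev Q x = ev P x)}"
  have openE: "open E" unfolding E_def by (intro open_Union) auto
  have EU: "E \<subseteq> U" unfolding E_def by blast
  have "\<exists>V. open V \<and> x \<in> V \<and> V \<subseteq> U - E" if x: "x \<in> U - E" for x
  proof -
    obtain V P' Q' where V: "open V" "x \<in> V" "V \<subseteq> U" "Q' \<noteq> 0" "\<forall>x\<in>V. f x * ev Q' x = ev P' x"
      using local_quotient[OF rat U(1) DiffD1[OF x]] by (elim exE conjE) (rule that)
    have "V \<inter> E = {}"
    proof (rule ccontr)
      assume "V \<inter> E \<noteq> {}"
      then obtain y where y: "y \<in> V \<inter> E" by blast
      have "P' * Q - P * Q' = 0"
      proof (rule polyfun_eq_0_open[OF _ y])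
        show "open (V \<inter> E)" using V openE by blast
        fix z assume z: "z \<in> V \<inter> E"
        have "f z * ev Q z = ev P z" using z unfolding E_def by blast
        moreover have "f z * ev Q' z = ev P' z" using z V by blast
        ultimately show "ev (P' * Q - P * Q') z = 0" by (simp flip: \<open>f z * ev Q z = ev P z\<close> \<open>f z * ev Q' z = ev P' z\<close>)
      qed
      then have PQ: "P' * Q = P * Q'" by simp
      have "f z * ev Q z = ev P z" if "z \<in> V" for z
      proof (rule rational_identity_extends[OF rational_along_lines_subset[OF rat V(3)] V(1) that V(4)])
        fix x assume x: "x \<in> V" "ev Q' x \<noteq> 0"
        have "ev Q' x * (f x * ev Q x) = (f x * ev Q' x) * ev Q x" by simp
        also have "\<dots> = ev (P' * Q) x" using V(5) x by simp
        also have "\<dots> = ev Q' x * ev P x" unfolding PQ by simp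
        finally show "f x * ev Q x = ev P x" using x by simp
      qed
      then have "V \<subseteq> E" using V unfolding E_def by blast
      then show False using V x by blast
    qed
    then show ?thesis using V by blast
  qed
  then have "open (U - E)" by (subst open_subopen) simp
  moreover have "E \<inter> U \<noteq> {}" using V0 unfolding E_def by blast
  ultimately have "(U - E) \<inter> U = {}"
    using connectedD[OF U(2) openE, of "U - E"] by blast
  then have "\<forall>x\<in>U. f x * ev Q x = ev P x" unfolding E_def by blast
  then show ?thesis using V0(4) by blast
qed

text \<open>A denominator of least total degree works: a common nonunit factor could be cancelled,
  even at its zeros by \<open>rational_identity_extends\<close>, and that would lower the
  degree.\<close>

lemma reduced_quotient:
  fixes f :: "real^'n::finite \<Rightarrow> real"
  assumes rat: "rational_along_lines U f" and U: "open U" "connected U" "U \<noteq> {}"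
  obtains P Q where "Q \<noteq> 0" "\<And>x. x \<in> U \<Longrightarrow> f x * ev Q x = ev P x"
    "\<And>G. G dvd P \<Longrightarrow> G dvd Q \<Longrightarrow> G dvd 1"
proof -
  define N where "N Q \<longleftrightarrow> Q \<noteq> 0 \<and> (\<exists>P. \<forall>x\<in>U. f x * ev Q x = ev P x)" for Q
  obtain Q0 where Q0: "N Q0" using global_quotient[OF assms] unfolding N_def by blast
  define Q where "Q = arg_min tdegree N"
  have "N Q" using arg_min_natI[of N, OF Q0] unfolding Q_def .
  have Q_min: "tdegree Q \<le> tdegree Q'" if "N Q'" for Q'
    using that unfolding Q_def by (rule arg_min_nat_le)
  obtain P where PQ: "Q \<noteq> 0" "\<forall>x\<in>U. f x * ev Q x = ev P x" using \<open>N Q\<close> unfolding N_def by blast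
  have "G dvd 1" if G: "G dvd P" "G dvd Q" for G
  proof (rule ccontr)
    assume nonunit: "\<not> G dvd 1"
    obtain P1 where P1: "P = G * P1" using G(1) by (rule dvdE)
    obtain Q1 where Q1: "Q = G * Q1" using G(2) by (rule dvdE)
    have nz: "G \<noteq> 0" "Q1 \<noteq> 0" using PQ(1) Q1 by auto
    have "f y * ev Q1 y = ev P1 y" if "y \<in> U" for y
    proof (rule rational_identity_extends[OF rat U(1) that nz(1)])
      fix x assume x: "x \<in> U" "ev G x \<noteq> 0"
      have "ev G x * (f x * ev Q1 x) = f x * ev Q x" unfolding Q1 by simp
      also have "\<dots> = ev G x * ev P1 x" using PQ(2) x unfolding P1 by simp
      finally show "f x * ev Q1 x = ev P1 x" using x by simp
    qed
    then have "N Q1" unfolding N_def using nz by blast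
    then have "tdegree G = 0" using Q_min[of Q1] tdegree_mult[OF nz] unfolding Q1 by simp
    then show False using tdegree_unit nz nonunit by blast
  qed
  then show thesis using that PQ by blast
qed

subsection \<open>The reduced denominator\<close>

lemma ev_Abs_compose:
  assumes "\<And>i x. g x $ i = ev (G i) x"
  shows "ev (Abs_polyfun (\<lambda>x. ev P (g x))) x = ev P (g x)"
proof -
  obtain P' where P': "\<And>x. ev P' x = ev P (g x)" using polyfun_compose[of g G P, OF assms] by blast
  then have "(\<lambda>x. ev P (g x)) = ev P'" by (intro ext) simp
  then show ?thesis by (simp add: ev_inverse P')
qed

text \<open>Mutually inverse polynomial maps induce inverse ring isomorphisms: a common factor is
  carried over, and the inverse of the resulting unit is carried back.\<close>

lemma coprime_compose:
  fixes \<phi> :: "real^'m::finite \<Rightarrow> real^'n::finite"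
  assumes \<phi>: "\<And>i x. \<phi> x $ i = ev (F i) x" and \<psi>: "\<And>i y. \<psi> y $ i = ev (F' i) y"
    and inv: "\<And>y. \<phi> (\<psi> y) = y" "\<And>x. \<psi> (\<phi> x) = x"
    and P': "\<And>x. ev P' x = ev P (\<phi> x)" and Q': "\<And>x. ev Q' x = ev Q (\<phi> x)"
    and coprime: "\<And>G. G dvd P \<Longrightarrow> G dvd Q \<Longrightarrow> G dvd 1"
    and G: "G dvd P'" "G dvd Q'"
  shows "G dvd 1"
proof -
  define pull where "pull R = Abs_polyfun (\<lambda>x. ev R (\<phi> x))" for R :: "'n polyfun"
  define push where "push R = Abs_polyfun (\<lambda>y. ev R (\<psi> y))" for R :: "'m polyfun"
  have pull: "ev (pull R) x = ev R (\<phi> x)" for R x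
    unfolding pull_def by (rule ev_Abs_compose[OF \<phi>])
  have push: "ev (push R) y = ev R (\<psi> y)" for R y
    unfolding push_def by (rule ev_Abs_compose[OF \<psi>])
  obtain P1 where P1: "P' = G * P1" using G(1) by (rule dvdE)
  obtain Q1 where Q1: "Q' = G * Q1" using G(2) by (rule dvdE)
  have "P = push G * push P1"
  proof (rule polyfun_eqI)
    fix y
    have "ev P y = ev P' (\<psi> y)" by (simp add: P' inv)
    then show "ev P y = ev (push G * push P1) y" by (simp add: P1 push)
  qed
  moreover have "Q = push G * push Q1"
  proof (rule polyfun_eqI)
    fix y
    have "ev Q y = ev Q' (\<psi> y)" by (simp add: Q' inv)
    then show "ev Q y = ev (push G * push Q1) y" by (simp add: Q1 push)
  qed
  ultimately have "push G dvd 1" using coprime[of "push G"] by simp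
  then obtain u where u: "1 = push G * u" by (rule dvdE)
  have "1 = G * pull u"
  proof (rule polyfun_eqI)
    fix x
    have "ev 1 (\<phi> x) = ev (push G * u) (\<phi> x)" using u by simp
    then show "ev 1 x = ev (G * pull u) x" by (simp add: push pull inv)
  qed
  then show ?thesis by (rule dvdI)
qed

lemma poly2_eq_0:
  fixes F :: "real poly poly"
  assumes "\<delta> > 0" "\<And>s t. s \<in> {- \<delta><..<\<delta>} \<Longrightarrow> t \<in> {- \<delta><..<\<delta>} \<Longrightarrow> poly (poly F [:s:]) t = 0"
  shows "F = 0"
proof (rule poly_eq_0_if_infinite_roots)
  have "inj_on (\<lambda>s :: real. [:s:]) {- \<delta><..<\<delta>}" by (auto intro: inj_onI)
  then show "infinite ((\<lambda>s. [:s:]) ` {- \<delta><..<\<delta>})"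
    using finite_imageD infinite_symmetric_interval[OF assms(1)] by blast
  fix S assume "S \<in> (\<lambda>s. [:s:]) ` {- \<delta><..<\<delta>}"
  then obtain s where s: "S = [:s:]" "s \<in> {- \<delta><..<\<delta>}" by blast
  show "poly F S = 0"
    unfolding s(1) using assms(2)[OF s(2)]
    by (rule poly_eq_0_if_infinite_roots[OF infinite_symmetric_interval[OF assms(1)]])
qed

text \<open>The second hypothesis says that X does not divide F, so X divides the cofactor W; powers
  of X are removed one at a time.\<close>

lemma cancel_X_power:
  fixes F :: "'a::idom poly"
  assumes "[:0, 1:] ^ m * U = F * W" "poly F 0 \<noteq> 0"
  shows "F dvd U"
  using assms(1)
proof (induction m arbitrary: W)
  case 0
  then show ?case by simp
next
  case (Suc m)
  have "poly F 0 * poly W 0 = 0" using arg_cong[OF Suc.prems, of "\<lambda>r. poly r 0"] by simp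
  then have "[:- 0, 1:] dvd W" using assms(2) poly_eq_0_iff_dvd[of W 0] by simp
  then obtain W1 where "W = [:0, 1:] * W1" by (auto elim: dvdE)
  then have "[:0, 1:] * ([:0, 1:] ^ m * U) = [:0, 1:] * (F * W1)"
    using Suc.prems by (simp only: power_Suc ac_simps)
  then have "[:0, 1:] ^ m * U = F * W1"
    by (subst (asm) mult_left_cancel) auto
  then show ?case by (rule Suc.IH)
qed

lemma poly_lift_const: "poly (map_poly (\<lambda>c. [:c:]) r) [:s:] = [:poly r s:]"
  for r :: "real poly"
  by (induction r) (simp_all add: map_poly_pCons)

text \<open>If the reduced denominator vanished at \<open>a\<close>, so would the numerator. In coordinates where
  it does not vanish identically along the \<open>k\<close>-th axis through \<open>a\<close>, Bezout gives a combination of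
  numerator and denominator free of the \<open>k\<close>-th variable. On a plane containing that axis, this
  forces the denominator to divide, near \<open>a\<close>, the denominator of the planar restriction, which is
  nonzero at \<open>a\<close>.\<close>

lemma reduced_denominator_nonzero:
  fixes f :: "real^'n::finite \<Rightarrow> real"
  assumes planes: "\<forall>M. affine M \<and> aff_dim M = 2 \<longrightarrow> (\<forall>C \<in> components (U \<inter> M). regular_on C f)"
    and U: "open U" "a \<in> U"
    and Q0: "Q \<noteq> 0" and fPQ: "\<And>x. x \<in> U \<Longrightarrow> f x * ev Q x = ev P x"
    and coprime: "\<And>G. G dvd P \<Longrightarrow> G dvd Q \<Longrightarrow> G dvd 1"
  shows "ev Q a \<noteq> 0"
proof
  assume Qa: "ev Q a = 0"
  then have Pa: "ev P a = 0" using fPQ[OF U(2)] by simp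
  obtain y where y: "ev Q y \<noteq> 0" using polyfun_nonzero[OF Q0] by blast
  \<comment> \<open>Q is not identically zero on the line through a in direction e; this becomes the
    k-th axis.\<close>
  define e where "e = y - a"
  have "e \<noteq> 0" using y Qa unfolding e_def by auto
  then obtain k where k: "e $ k \<noteq> 0" by (auto simp: vec_eq_iff)
  \<comment> \<open>Affine coordinates that send the origin to a and replace only the k-th basis
    vector, by e. They are invertible because \<open>e $ k\<close> is nonzero.\<close>
  define \<phi> where "\<phi> x = a + x + x $ k *\<^sub>R (e - axis k 1)" for x
  define \<psi> where "\<psi> y = (y - a) - ((y - a) $ k / e $ k) *\<^sub>R (e - axis k 1)" for y
  have inv1: "\<phi> (\<psi> y) = y" for y
  proof -
    have "\<psi> y $ k = (y - a) $ k / e $ k" unfolding \<psi>_def using k by (simp add: field_simps axis_def)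
    then show ?thesis unfolding \<phi>_def by (simp add: \<psi>_def)
  qed
  have inv2: "\<psi> (\<phi> x) = x" for x
  proof -
    have "(\<phi> x - a) $ k / e $ k = x $ k" unfolding \<phi>_def using k by (simp add: field_simps axis_def)
    then show ?thesis unfolding \<psi>_def by (simp add: \<phi>_def)
  qed
  define F where "F i = Const (a $ i) + Coord i + Coord k * Const ((e - axis k 1) $ i)" for i
  define F' where "F' i = (Coord i - Const (a $ i)) -
     (Coord k - Const (a $ k)) * Const (1 / e $ k) * Const ((e - axis k 1) $ i)" for i
  have F: "\<phi> x $ i = ev (F i) x" for x i unfolding \<phi>_def F_def by simp
  have F': "\<psi> y $ i = ev (F' i) y" for y i unfolding \<psi>_def F'_def by simp
  obtain P' where P': "\<And>x. ev P' x = ev P (\<phi> x)" using polyfun_compose[of \<phi> F P, OF F] by blast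
  obtain Q' where Q': "\<And>x. ev Q' x = ev Q (\<phi> x)" using polyfun_compose[of \<phi> F Q, OF F] by blast
  have \<phi>0: "\<phi> 0 = a" unfolding \<phi>_def by simp
  have \<phi>_axis: "\<phi> (axis k 1) = y" unfolding \<phi>_def e_def by simp
  have "Q' \<noteq> 0" using Q'[of "axis k 1"] \<phi>_axis y by auto
  have coprime': "G dvd 1" if "G dvd P'" "G dvd Q'" for G
    using F F' inv1 inv2 P' Q' coprime that by (rule coprime_compose)
  obtain A B where AB: "A * P' + B * Q' \<in> depends_on (UNIV - {k})" "A * P' + B * Q' \<noteq> 0"
    using polyfun_bezout[of P' Q' k] coprime' \<open>Q' \<noteq> 0\<close> by blast
  define R where "R = A * P' + B * Q'"
  have R: "ev R x = ev R x'" if "\<And>i. i \<noteq> k \<Longrightarrow> x $ i = x' $ i" for x x'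
    unfolding R_def by (rule depends_onD[OF AB(1)]) (use that in auto)
  obtain w0 where "ev R w0 \<noteq> 0" using polyfun_nonzero[OF AB(2)] unfolding R_def by blast
  \<comment> \<open>R ignores the k-th coordinate, so it may be set to 0; this makes w independent
    of e. Since R vanishes at 0 but not at w, the vector w is nonzero.\<close>
  define w where "w = upd w0 k 0"
  have "ev R w = ev R w0" by (rule R) (simp add: w_def)
  then have Rw: "ev R w \<noteq> 0" using \<open>ev R w0 \<noteq> 0\<close> by simp
  have wk: "w $ k = 0" unfolding w_def by simp
  have "ev R 0 = 0" unfolding R_def by (simp add: P' Q' \<phi>0 Pa Qa)
  then have "w \<noteq> 0" using Rw by auto
  have w_span: "w \<notin> span {e}"
  proof
    assume "w \<in> span {e}"
    then obtain c where c: "w = c *\<^sub>R e" by (auto simp: span_singleton)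
    then have "c * e $ k = 0" using wk by simp
    then show False using k c \<open>w \<noteq> 0\<close> by simp
  qed
  have \<phi>_plane: "\<phi> (0 + s *\<^sub>R w + t *\<^sub>R axis k 1) = a + s *\<^sub>R w + t *\<^sub>R e" for s t
    unfolding \<phi>_def by (simp add: wk algebra_simps)
  obtain \<epsilon> where \<epsilon>: "\<epsilon> > 0" "ball a \<epsilon> \<subseteq> U" using U open_contains_ball by blast
  define M where "M = (+) a ` span {w, e}"
  define L where "L = ball a \<epsilon> \<inter> M"
  have affM: "affine M" "aff_dim M = 2" unfolding M_def by (rule affine_plane[OF \<open>e \<noteq> 0\<close> w_span])+
  have "connected L" unfolding L_def
    by (intro convex_connected convex_Int convex_ball affine_imp_convex affM)
  then have "regular_on L f"
    by (rule regular_on_planar_connected[OF planes affM]) (use \<epsilon> in \<open>auto simp: L_def\<close>)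
  moreover have plane_M: "a + s *\<^sub>R w + t *\<^sub>R e \<in> M" for s t
  proof -
    have "s *\<^sub>R w + t *\<^sub>R e \<in> span {w, e}" by (intro span_add span_scale span_base) auto
    then show ?thesis unfolding M_def by (simp add: add.assoc)
  qed
  have "a \<in> L" using plane_M[of 0 0] \<epsilon> unfolding L_def by simp
  ultimately obtain p q where pq: "polynomial_fun p" "polynomial_fun q" "q a \<noteq> 0"
    "\<forall>x\<in>L. q x \<noteq> 0 \<longrightarrow> f x = p x / q x" unfolding regular_on_def by blast
  obtain p1 where p1: "\<And>x. p x = ev p1 x" using polynomial_funE[OF pq(1)] by blast
  obtain q1 where q1: "\<And>x. q x = ev q1 x" using polynomial_funE[OF pq(2)] by blast
  define \<delta> where "\<delta> = \<epsilon> / (norm w + norm e + 1)"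
  have "\<delta> > 0" unfolding \<delta>_def using \<epsilon> by (simp add: add_nonneg_pos)
  have small: "a + s *\<^sub>R w + t *\<^sub>R e \<in> L" if "s \<in> {- \<delta><..<\<delta>}" "t \<in> {- \<delta><..<\<delta>}" for s t
  proof -
    have "norm (s *\<^sub>R w + t *\<^sub>R e) \<le> \<bar>s\<bar> * norm w + \<bar>t\<bar> * norm e"
      by (metis norm_scaleR norm_triangle_ineq)
    also have "\<dots> \<le> \<delta> * norm w + \<delta> * norm e"
      using that by (intro add_mono mult_right_mono) auto
    also have "\<dots> < \<delta> * (norm w + norm e + 1)" using \<open>\<delta> > 0\<close> by (simp add: algebra_simps)
    also have "\<dots> = \<epsilon>" unfolding \<delta>_def by (simp add: add_nonneg_eq_0_iff)
    finally have "norm (s *\<^sub>R w + t *\<^sub>R e) < \<epsilon>" .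
    then have "dist a (a + s *\<^sub>R w + t *\<^sub>R e) < \<epsilon>"
      by (simp add: dist_norm add.assoc norm_minus_commute add.commute[of "t *\<^sub>R e"])
    then show ?thesis unfolding L_def using plane_M by simp
  qed
  obtain FP where FP: "\<And>s t. ev P' (0 + s *\<^sub>R w + t *\<^sub>R axis k 1) = poly (poly FP [:s:]) t"
    using polyfun_on_plane by blast
  obtain FQ where FQ: "\<And>s t. ev Q' (0 + s *\<^sub>R w + t *\<^sub>R axis k 1) = poly (poly FQ [:s:]) t"
    using polyfun_on_plane by blast
  obtain FA where FA: "\<And>s t. ev A (0 + s *\<^sub>R w + t *\<^sub>R axis k 1) = poly (poly FA [:s:]) t"
    using polyfun_on_plane by blast
  obtain FB where FB: "\<And>s t. ev B (0 + s *\<^sub>R w + t *\<^sub>R axis k 1) = poly (poly FB [:s:]) t"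
    using polyfun_on_plane by blast
  obtain Fp where Fp: "\<And>s t. ev p1 (a + s *\<^sub>R w + t *\<^sub>R e) = poly (poly Fp [:s:]) t"
    using polyfun_on_plane by blast
  obtain Fq where Fq: "\<And>s t. ev q1 (a + s *\<^sub>R w + t *\<^sub>R e) = poly (poly Fq [:s:]) t"
    using polyfun_on_plane by blast
  have Fq0: "poly (poly Fq [:0:]) 0 \<noteq> 0" using Fq[of 0 0] pq(3) q1 by simp
  have FQ0: "poly (poly FQ [:0:]) 0 = 0" using FQ[of 0 0] Q'[of 0] \<phi>0 Qa by simp
  have FQ1: "poly (poly FQ [:0:]) 1 \<noteq> 0" using FQ[of 0 1] Q'[of "axis k 1"] \<phi>_axis y by simp
  \<comment> \<open>The extra factor \<open>Fq\<close> covers the points where the planar quotient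
    says nothing; being a nonzero polynomial it is cancelled afterwards.\<close>
  have "Fq * (FP * Fq - Fp * FQ) = 0"
  proof (rule poly2_eq_0[OF \<open>\<delta> > 0\<close>])
    fix s t assume st: "s \<in> {- \<delta><..<\<delta>}" "t \<in> {- \<delta><..<\<delta>}"
    define x where "x = a + s *\<^sub>R w + t *\<^sub>R e"
    have xL: "x \<in> L" unfolding x_def by (rule small[OF st])
    then have "x \<in> U" using \<epsilon> unfolding L_def by blast
    have eP: "ev P x = poly (poly FP [:s:]) t" using FP[of s t] by (simp only: P' \<phi>_plane x_def)
    have eQ: "ev Q x = poly (poly FQ [:s:]) t" using FQ[of s t] by (simp only: Q' \<phi>_plane x_def)
    have ep: "ev p1 x = poly (poly Fp [:s:]) t" unfolding x_def by (rule Fp)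
    have eq: "ev q1 x = poly (poly Fq [:s:]) t" unfolding x_def by (rule Fq)
    have "ev q1 x * (ev P x * ev q1 x - ev p1 x * ev Q x) = 0"
    proof (cases "ev q1 x = 0")
      case False
      then have "f x = ev p1 x / ev q1 x" using pq(4) xL p1 q1 by auto
      then have "f x * ev q1 x = ev p1 x" using False by simp
      then have "ev p1 x * ev Q x = (f x * ev Q x) * ev q1 x" by simp
      then show ?thesis unfolding fPQ[OF \<open>x \<in> U\<close>] by simp
    qed simp
    then show "poly (poly (Fq * (FP * Fq - Fp * FQ)) [:s:]) t = 0"
      by (simp only: eP eQ ep eq poly_mult poly_diff)
  qed
  moreover have "Fq \<noteq> 0" using Fq0 by auto
  ultimately have eq: "FP * Fq = Fp * FQ" by simp
  obtain r where r: "\<And>s. ev R (0 + s *\<^sub>R w) = poly r s" using polyfun_on_line by blast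
  have "poly r 1 \<noteq> 0" using r[of 1] Rw by simp
  then have "r \<noteq> 0" by auto
  \<comment> \<open>R vanishes at the origin, so r has a zero at s = 0. Splitting off the full power
    of s leaves a factor that is nonzero at a.\<close>
  then obtain r1 where r1: "r = [:- 0, 1:] ^ order 0 r * r1" "\<not> [:- 0, 1:] dvd r1"
    using order_decomp by blast
  have r10: "poly r1 0 \<noteq> 0" using r1(2) poly_eq_0_iff_dvd by blast
  define m where "m = order 0 r"
  define D where "D = map_poly (\<lambda>c. [:c:]) r1"
  have "[:0, 1:] ^ m * D - (FA * FP + FB * FQ) = 0"
  proof (rule poly2_eq_0[of 1])
    fix s t :: real
    define x where "x = 0 + s *\<^sub>R w + t *\<^sub>R axis k 1"
    have "poly (poly (FA * FP + FB * FQ) [:s:]) t = ev R x"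
      unfolding R_def x_def by (simp only: FA FB FP FQ ev_add ev_mult poly_add poly_mult)
    also have "\<dots> = ev R (0 + s *\<^sub>R w)"
      unfolding x_def by (rule R) (simp add: axis_def)
    also have "\<dots> = poly r s" by (rule r)
    finally have "poly (poly (FA * FP + FB * FQ) [:s:]) t = poly r s" .
    moreover have "poly r s = s ^ m * poly r1 s"
      by (subst r1(1)) (simp add: m_def)
    ultimately show "poly (poly ([:0, 1:] ^ m * D - (FA * FP + FB * FQ)) [:s:]) t = 0"
      by (simp add: D_def poly_lift_const)
  qed simp
  then have D: "[:0, 1:] ^ m * D = FA * FP + FB * FQ" by simp
  have "[:0, 1:] ^ m * (D * Fq) = (FA * FP + FB * FQ) * Fq" by (simp only: D[symmetric] mult.assoc)
  also have "\<dots> = FA * (FP * Fq) + FB * FQ * Fq" by (simp add: algebra_simps)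
  also have "\<dots> = FQ * (FA * Fp + FB * Fq)" unfolding eq by (simp add: algebra_simps)
  finally have "FQ dvd D * Fq"
  proof (rule cancel_X_power)
    \<comment> \<open>On the axis s = 0 the denominator is nonzero at t = 1, which corresponds to
      the point y; hence s does not divide \<open>FQ\<close>.\<close>
    show "poly FQ 0 \<noteq> 0" using FQ1 by auto
  qed
  then obtain W where "D * Fq = FQ * W" by (rule dvdE)
  \<comment> \<open>Evaluation at a: the right side vanishes with Q, while the left side is r1(0)
    times the nonzero value q(a).\<close>
  then have "poly (poly (D * Fq) [:0:]) 0 = poly (poly (FQ * W) [:0:]) 0" by (rule arg_cong)
  then have "poly (poly D [:0:]) 0 * poly (poly Fq [:0:]) 0 = 0" using FQ0 by simp
  moreover have "poly (poly D [:0:]) 0 = poly r1 0" unfolding D_def by (simp only: poly_lift_const) simp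
  ultimately show False using Fq0 r10 by simp
qed

theorem theorem6p1:
  fixes U :: "(real^'n) set" and f :: "real^'n \<Rightarrow> real"
  assumes "CARD('n) \<ge> 2" and "open U" and "connected U"
  shows "regular_on U f \<longleftrightarrow>
           (\<forall>M :: (real^'n) set. affine M \<and> aff_dim M = 2 \<longrightarrow>
              (\<forall>C \<in> components (U \<inter> M). regular_on C f))"
proof
  assume reg: "regular_on U f"
  show "\<forall>M. affine M \<and> aff_dim M = 2 \<longrightarrow> (\<forall>C \<in> components (U \<inter> M). regular_on C f)"
  proof (intro allI impI ballI)
    fix M C assume "C \<in> components (U \<inter> M)"
    then have "C \<subseteq> U" using in_components_subset by blast
    with reg show "regular_on C f" by (rule regular_on_subset)
  qed
next
  assume planes: "\<forall>M. affine M \<and> aff_dim M = 2 \<longrightarrow> (\<forall>C \<in> components (U \<inter> M). regular_on C f)"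
  show "regular_on U f"
  proof (cases "U = {}")
    case True
    then show ?thesis unfolding regular_on_def by simp
  next
    case False
    have rat: "rational_along_lines U f"
      unfolding rational_along_lines_def using rational_on_lines[OF planes assms(1)] by blast
    obtain P Q where PQ: "Q \<noteq> 0" "\<And>x. x \<in> U \<Longrightarrow> f x * ev Q x = ev P x"
      "\<And>G. G dvd P \<Longrightarrow> G dvd Q \<Longrightarrow> G dvd 1"
      by (rule reduced_quotient[OF rat assms(2,3) False]) (rule that)
    have nz: "ev Q x \<noteq> 0" if "x \<in> U" for x
      by (rule reduced_denominator_nonzero[OF planes assms(2) that PQ])
    have "f x = ev P x / ev Q x" if "x \<in> U" for x
      using PQ(2)[OF that] nz[OF that] by (simp add: eq_divide_eq)
    then show ?thesis unfolding regular_on_def using nz polynomial_fun_ev by blast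
  qed
qed

end
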